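(* Let $S\subset\mathbb{R}^n_+$ be compact and convex with $0\in S$ and set $\sigma_S=\varphi_S(\mathbf{1})$. Then the following are equivalent: (i) $S$ is a lower set; (ii) $S=\widehat S_{\mathbb{R}^n_+}$; (iii) $\varphi_S(\xi)=\varphi_S(\xi^+)$ for every $\xi\in\mathbb{R}^n$; (iv) $H_S(z-w)\le\sigma_S\|w\|_\infty+H_S(z)$ for all $z,w\in\mathbb{C}^n$; (v) $\mathcal{L}^S(\mathbb{C}^n)$ is translation invariant, i.e. $u\in\mathcal{L}^S(\mathbb{C}^n)$ implies $u(\cdot-w)\in\mathcal{L}^S(\mathbb{C}^n)$ for every $w\in\mathbb{C}^n$; (vi) if $u\in\mathcal{L}^S(\mathbb{C}^n)$, then $u*\psi_\delta\in\mathcal{L}^S(\mathbb{C}^n)$ for every radially symmetric $\psi\in\mathcal{C}^\infty_0(\mathbb{C}^n)$ with $\psi\ge0$, $\int_{\mathbb{C}^n}\psi\,d\lambda=1$, and $\psi_\delta(\zeta)=\delta^{-2n}\psi(\zeta/\delta)$, $\delta>0$.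
   Context: $\mathbb{R}_+=[0,\infty)$, $\mathbf{1}=(1,\dots,1)$, $\xi^+=(\max\{\xi_1,0\},\dots,\max\{\xi_n,0\})$, $\lambda$ is Lebesgue measure. $\varphi_S(\xi)=\max_{s\in S}\langle s,\xi\rangle$. $H_S(z)=\varphi_S(\log|z_1|,\dots,\log|z_n|)$ for $z\in(\mathbb{C}\setminus\{0\})^n$, extended to the coordinate hyperplanes by $\limsup$ from $(\mathbb{C}\setminus\{0\})^n$. $\mathcal{L}^S(\mathbb{C}^n)$: plurisubharmonic $u$ on $\mathbb{C}^n$ with $u\le c_u+H_S$ for a constant $c_u$. $S$ is a lower set if for every $s\in S$ the box $[0,s_1]\times\cdots\times[0,s_n]$ is contained in $S$. $\widehat S_{\mathbb{R}^n_+}=\{x\in\mathbb{R}^n_+\,;\,\langle x,\xi\rangle\le\varphi_S(\xi)\ \forall\xi\in\mathbb{R}^n_+\}$. *)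

theory Defs
  imports "HOL-Analysis.Analysis" "HOL-Probability.Probability"
begin

definition phiS :: "(real^'n) set \<Rightarrow> real^'n \<Rightarrow> real" where
  "phiS S \<xi> = (SUP s\<in>S. inner s \<xi>)"

definition posvec :: "real^'n \<Rightarrow> real^'n" where
  "posvec \<xi> = (\<chi> i. max (\<xi>$i) 0)"

definition onevec :: "real^'n" where
  "onevec = (\<chi> i. 1)"

definition nonneg_orthant :: "(real^'n) set" where
  "nonneg_orthant = {x. \<forall>i. 0 \<le> x$i}"

definition lower_set :: "(real^'n) set \<Rightarrow> bool" where
  "lower_set S \<longleftrightarrow> (\<forall>s\<in>S. \<forall>x. (\<forall>i. 0 \<le> x$i \<and> x$i \<le> s$i) \<longrightarrow> x \<in> S)"

definition S_hat :: "(real^'n) set \<Rightarrow> (real^'n) set" where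
  "S_hat S = {x \<in> nonneg_orthant. \<forall>\<xi>\<in>nonneg_orthant. inner x \<xi> \<le> phiS S \<xi>}"

definition logabs :: "complex^'n \<Rightarrow> real^'n" where
  "logabs z = (\<chi> i. ln (cmod (z$i)))"

definition torus :: "(complex^'n) set" where
  "torus = {z. \<forall>i. z$i \<noteq> 0}"

definition HS :: "(real^'n) set \<Rightarrow> complex^'n \<Rightarrow> ereal" where
  "HS S z = (if z \<in> torus then ereal (phiS S (logabs z))
             else Limsup (at z within torus) (\<lambda>w. ereal (phiS S (logabs w))))"

definition supnorm :: "complex^'n \<Rightarrow> real" where
  "supnorm w = Max (range (\<lambda>i. cmod (w$i)))"

definition ereal_integral :: "'a measure \<Rightarrow> ('a \<Rightarrow> ereal) \<Rightarrow> ereal" where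
  "ereal_integral M f =
     enn2ereal (\<integral>\<^sup>+ x. e2ennreal (f x) \<partial>M) - enn2ereal (\<integral>\<^sup>+ x. e2ennreal (- f x) \<partial>M)"

definition usc :: "('a::topological_space \<Rightarrow> ereal) \<Rightarrow> bool" where
  "usc u \<longleftrightarrow> (\<forall>z c. u z < c \<longrightarrow> eventually (\<lambda>w. u w < c) (at z))"

definition psh :: "(complex^'n \<Rightarrow> ereal) \<Rightarrow> bool" where
  "psh u \<longleftrightarrow> usc u \<and> (\<forall>z. u z \<noteq> \<infinity>) \<and>
     (\<forall>a b. \<forall>\<zeta>::complex. \<forall>r>0.
        u (a + \<zeta> *s b) \<le>
          ereal (1 / (2*pi)) *
          ereal_integral (lebesgue_on {0..2*pi})
            (\<lambda>\<theta>. u (a + (\<zeta> + of_real r * cis \<theta>) *s b)))"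

definition LS :: "(real^'n) set \<Rightarrow> (complex^'n \<Rightarrow> ereal) set" where
  "LS S = {u. psh u \<and> (\<exists>c::real. \<forall>z. u z \<le> ereal c + HS S z)}"

fun Ck :: "nat \<Rightarrow> ('a::euclidean_space \<Rightarrow> real) \<Rightarrow> bool" where
  "Ck 0 f = continuous_on UNIV f"
| "Ck (Suc k) f = (continuous_on UNIV f \<and> (\<forall>x. f differentiable (at x)) \<and>
                    (\<forall>b\<in>Basis. Ck k (\<lambda>x. frechet_derivative f (at x) b)))"

definition smooth :: "('a::euclidean_space \<Rightarrow> real) \<Rightarrow> bool" where
  "smooth f \<longleftrightarrow> (\<forall>k. Ck k f)"

definition mollifier :: "(complex^'n \<Rightarrow> real) \<Rightarrow> bool" where
  "mollifier \<psi> \<longleftrightarrow> smooth \<psi> \<and> bounded {\<zeta>. \<psi> \<zeta> \<noteq> 0} \<and> (\<forall>\<zeta>. 0 \<le> \<psi> \<zeta>) \<and>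
     (\<forall>\<zeta> \<eta>. norm \<zeta> = norm \<eta> \<longrightarrow> \<psi> \<zeta> = \<psi> \<eta>) \<and>
     integral\<^sup>L lborel \<psi> = 1"

definition scaled :: "(complex^'n \<Rightarrow> real) \<Rightarrow> real \<Rightarrow> complex^'n \<Rightarrow> real" where
  "scaled \<psi> \<delta> \<zeta> = inverse (\<delta> ^ (2 * CARD('n))) * \<psi> (inverse \<delta> *\<^sub>R \<zeta>)"

definition convol :: "(complex^'n \<Rightarrow> ereal) \<Rightarrow> (complex^'n \<Rightarrow> real) \<Rightarrow> complex^'n \<Rightarrow> ereal" where
  "convol u \<phi> z = ereal_integral lborel (\<lambda>\<zeta>. u (z - \<zeta>) * ereal (\<phi> \<zeta>))"

end

theory Submission
  imports Defs "HOL-Complex_Analysis.Cauchy_Integral_Formula"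
begin

text \<open>
  The equivalence of (i), (ii), (iii) is convex duality: zeroing the coordinates of s where \<xi> is
  negative turns the pairing with \<xi> into the pairing with its positive part, and a compact convex
  set is recovered from its support function. If S is a lower set, then HS is the support function
  composed with the coordinatewise positive part of log |z|, which is Lipschitz; this gives (iv),
  and with it the growth bounds in (v) and (vi).

  Conversely, every s in S yields a member of LS, namely the positive part of the pairing of s with
  log |z|. It is continuous and nonnegative, and it is plurisubharmonic by Jensen's inequality on
  circles avoiding its singularities, followed by continuity in the radius. Translating or
  smoothing it removes the decay in the coordinates tending to 0, so its growth along the ray of
  \<xi> is governed by the positive part of \<xi>, whereas HS grows like the support function at \<xi>.
  This forces (iii).
\<close>

section \<open>Support functions and lower sets\<close>

text \<open>Off \<open>torus\<close>, \<open>HS\<close> is a limsup that is not evaluated for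
  general \<open>S\<close>. The converses use only its values at the points
  \<open>expvec \<xi>\<close> and its lower bounds by continuous functions that lie below it on
  \<open>torus\<close>. Points with \<open>logabs\<close> equal to n \<xi> are used because dividing
  by n removes the unknown additive constant in the growth bounds. From (iv) or (v) one well chosen
  translate of the witness suffices. From (vi) only an average over translates is available, so
  almost every translate must have the right growth, and the exceptional shifts must form a null
  set. The other obstacle is that \<open>ereal_integral\<close> is a difference of two possibly
  infinite integrals, while plurisubharmonic functions may take the value -infinity. Subtracting
  from a local upper bound turns each comparison of averages into one between integrals of
  nonnegative functions.\<close>

lemma bdd_above_inner_compact:
  fixes S :: "(real^'n) set"
  assumes "compact S"
  shows "bdd_above ((\<lambda>s. inner s \<xi>) ` S)"
  by (intro bounded_imp_bdd_above compact_imp_bounded compact_continuous_image assms continuous_intros)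

lemma inner_le_phiS:
  fixes S :: "(real^'n) set"
  assumes "compact S" "s \<in> S"
  shows "inner s \<xi> \<le> phiS S \<xi>"
  unfolding phiS_def using bdd_above_inner_compact[OF assms(1)] assms(2) by (rule cSUP_upper2) simp

lemma phiS_nonneg:
  fixes S :: "(real^'n) set"
  assumes "compact S" "0 \<in> S"
  shows "0 \<le> phiS S \<xi>"
  using inner_le_phiS[OF assms, of \<xi>] by simp

lemma phiS_le_iff:
  fixes S :: "(real^'n) set"
  assumes "compact S" "S \<noteq> {}"
  shows "phiS S \<xi> \<le> c \<longleftrightarrow> (\<forall>s\<in>S. inner s \<xi> \<le> c)"
  unfolding phiS_def by (rule cSUP_le_iff[OF assms(2) bdd_above_inner_compact[OF assms(1)]])

lemma phiS_add_le:
  fixes S :: "(real^'n) set"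
  assumes "compact S" "S \<noteq> {}"
  shows "phiS S (\<xi> + \<eta>) \<le> phiS S \<xi> + phiS S \<eta>"
  unfolding phiS_le_iff[OF assms] inner_add_right
  by (intro ballI add_mono inner_le_phiS assms)

lemma phiS_scaleR_le:
  fixes S :: "(real^'n) set"
  assumes "compact S" "S \<noteq> {}" "t \<ge> 0"
  shows "phiS S (t *\<^sub>R \<xi>) \<le> t * phiS S \<xi>"
  unfolding phiS_le_iff[OF assms(1,2)] inner_scaleR_right
  by (intro ballI mult_left_mono inner_le_phiS assms)

lemma inner_mono_nonneg:
  fixes s :: "real^'n"
  assumes "\<And>i. 0 \<le> s $ i" "\<And>i. \<xi> $ i \<le> \<eta> $ i"
  shows "inner s \<xi> \<le> inner s \<eta>"
  unfolding inner_vec_def by (intro sum_mono) (simp add: assms mult_left_mono)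

lemma phiS_mono:
  fixes S :: "(real^'n) set"
  assumes "compact S" "S \<noteq> {}" "S \<subseteq> nonneg_orthant" "\<And>i. \<xi> $ i \<le> \<eta> $ i"
  shows "phiS S \<xi> \<le> phiS S \<eta>"
  unfolding phiS_le_iff[OF assms(1,2)]
proof
  fix s assume s: "s \<in> S"
  have "inner s \<xi> \<le> inner s \<eta>"
    using assms(3,4) s by (intro inner_mono_nonneg) (auto simp: nonneg_orthant_def)
  also have "\<dots> \<le> phiS S \<eta>" by (rule inner_le_phiS[OF assms(1) s])
  finally show "inner s \<xi> \<le> phiS S \<eta>" .
qed

lemma posvec_nth [simp]: "posvec \<xi> $ i = max (\<xi> $ i) 0"
  by (simp add: posvec_def)

lemma phiS_posvec_if_lower_set:
  fixes S :: "(real^'n) set"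
  assumes "compact S" "S \<noteq> {}" "S \<subseteq> nonneg_orthant" "lower_set S"
  shows "phiS S \<xi> = phiS S (posvec \<xi>)"
proof (rule antisym)
  show "phiS S \<xi> \<le> phiS S (posvec \<xi>)"
    using assms by (intro phiS_mono) auto
  show "phiS S (posvec \<xi>) \<le> phiS S \<xi>"
    unfolding phiS_le_iff[OF assms(1,2)]
  proof
    fix s assume s: "s \<in> S"
    define s' where "s' = (\<chi> i. if \<xi> $ i > 0 then s $ i else 0)"
    have "s' \<in> S"
      using assms(3,4) s unfolding lower_set_def nonneg_orthant_def s'_def
      by (force intro: order_refl)
    moreover have "inner s (posvec \<xi>) = inner s' \<xi>"
      unfolding inner_vec_def s'_def by (intro sum.cong) auto
    ultimately show "inner s (posvec \<xi>) \<le> phiS S \<xi>"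
      using inner_le_phiS[OF assms(1)] by simp
  qed
qed

lemma mem_if_inner_le_phiS:
  fixes S :: "(real^'n) set"
  assumes "compact S" "convex S" "S \<noteq> {}" "\<And>\<xi>. inner x \<xi> \<le> phiS S \<xi>"
  shows "x \<in> S"
proof (rule ccontr)
  assume "x \<notin> S"
  then obtain a b where ab: "inner a x < b" "\<forall>y\<in>S. inner a y > b"
    using separating_hyperplane_closed_point[OF assms(2) compact_imp_closed[OF assms(1)]] by blast
  \<comment> \<open>Separation places \<open>S\<close> above the hyperplane, so the direction
    violating the support inequality is \<open>- a\<close>.\<close>
  have "phiS S (- a) \<le> - b"
    unfolding phiS_le_iff[OF assms(1,3)] using ab(2) by (auto simp: inner_commute less_imp_le)
  then show False using assms(4)[of "- a"] ab(1) by (simp add: inner_commute)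
qed

lemma subset_S_hat:
  fixes S :: "(real^'n) set"
  assumes "compact S" "S \<subseteq> nonneg_orthant"
  shows "S \<subseteq> S_hat S"
  using assms(2) inner_le_phiS[OF assms(1)] by (auto simp: S_hat_def)

text \<open>The hull tests only nonnegative directions. Passing to the positive part of \<xi> can
  only increase the pairing with a nonnegative point and leaves the support function fixed, so these
  directions control all others.\<close>

lemma S_hat_eq_if_phiS_posvec:
  fixes S :: "(real^'n) set"
  assumes "compact S" "convex S" "S \<noteq> {}" "S \<subseteq> nonneg_orthant"
    and pos: "\<And>\<xi>. phiS S \<xi> = phiS S (posvec \<xi>)"
  shows "S = S_hat S"
proof
  show "S_hat S \<subseteq> S"
  proof
    fix x assume x: "x \<in> S_hat S"
    show "x \<in> S"
    proof (rule mem_if_inner_le_phiS[OF assms(1-3)])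
      fix \<xi> :: "real^'n"
      have "inner x \<xi> \<le> inner x (posvec \<xi>)"
        using x by (intro inner_mono_nonneg) (auto simp: S_hat_def nonneg_orthant_def)
      also have "\<dots> \<le> phiS S (posvec \<xi>)"
        using x by (auto simp: S_hat_def nonneg_orthant_def)
      finally show "inner x \<xi> \<le> phiS S \<xi>" using pos[of \<xi>] by simp
    qed
  qed
qed (rule subset_S_hat[OF assms(1,4)])

text \<open>Pairings with nonnegative directions decrease as coordinates shrink, whatever
  \<open>S\<close> is. This is the return from (ii) to (i).\<close>

lemma lower_set_S_hat: "lower_set (S_hat S)"
  unfolding lower_set_def
proof (intro ballI allI impI)
  fix s x assume s: "s \<in> S_hat S" and x: "\<forall>i. 0 \<le> x $ i \<and> x $ i \<le> s $ i"
  have "inner x \<xi> \<le> phiS S \<xi>" if "\<xi> \<in> nonneg_orthant" for \<xi>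
  proof -
    have "inner \<xi> x \<le> inner \<xi> s"
      using that x by (intro inner_mono_nonneg) (auto simp: nonneg_orthant_def)
    also have "\<dots> \<le> phiS S \<xi>" using s that by (auto simp: S_hat_def inner_commute)
    finally show ?thesis by (simp add: inner_commute)
  qed
  then show "x \<in> S_hat S" using x by (auto simp: S_hat_def nonneg_orthant_def)
qed

text \<open>Sublinearity gives convexity, and a finite convex function on a finite-dimensional space
  is continuous.\<close>

lemma continuous_on_phiS:
  fixes S :: "(real^'n) set"
  assumes "compact S" "S \<noteq> {}"
  shows "continuous_on UNIV (phiS S)"
proof -
  have "convex_on UNIV (phiS S)"
  proof (rule convex_onI)
    fix t :: real and x y :: "real^'n" assume t: "0 < t" "t < 1"
    have "phiS S ((1 - t) *\<^sub>R x + t *\<^sub>R y) \<le> phiS S ((1 - t) *\<^sub>R x) + phiS S (t *\<^sub>R y)"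
      by (rule phiS_add_le[OF assms])
    also have "\<dots> \<le> (1 - t) * phiS S x + t * phiS S y"
      using t by (intro add_mono phiS_scaleR_le assms) auto
    finally show "phiS S ((1 - t) *\<^sub>R x + t *\<^sub>R y) \<le> (1 - t) * phiS S x + t * phiS S y" .
  qed simp
  then show ?thesis by (rule convex_on_continuous[OF open_UNIV])
qed

section \<open>The logarithmic supporting function\<close>

text \<open>Along the trivial filter \<open>Limsup\<close> would be -infinity, so a limit yields the
  limsup only after this check. The approach is diagonal: small positive shifts make zero
  coordinates nonzero and keep the others nonzero.\<close>

lemma at_within_torus_neq_bot:
  fixes z :: "complex^'n"
  shows "at z within torus \<noteq> bot"
proof
  assume bot: "at z within torus = bot"
  define f where "f = (\<lambda>t::real. z + (\<chi> i. of_real t))"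
  have "\<forall>\<^sub>F t in at_right 0. f t $ i \<noteq> 0" for i
  proof (cases "z $ i = 0")
    case True
    then show ?thesis
      by (auto simp: f_def eventually_at_filter)
  next
    case False
    have "((\<lambda>t. f t $ i) \<longlongrightarrow> z $ i + of_real 0) (at_right 0)"
      unfolding f_def vector_add_component vec_lambda_beta by (intro tendsto_intros)
    then show ?thesis using False by (intro tendsto_imp_eventually_ne) auto
  qed
  then have "\<forall>\<^sub>F t in at_right 0. f t \<in> torus"
    unfolding torus_def mem_Collect_eq by (intro eventually_all_finite)
  moreover have "\<forall>\<^sub>F t in at_right 0. f t \<noteq> z"
    by (auto simp: f_def eventually_at_filter vec_eq_iff)
  moreover have "(f \<longlongrightarrow> z + (\<chi> i. of_real 0)) (at_right 0)"
    unfolding f_def by (intro tendsto_intros)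
  moreover have "z + (\<chi> i. of_real 0) = z" by (simp add: vec_eq_iff)
  ultimately have "filterlim f (at z within torus) (at_right 0)"
    by (simp add: filterlim_at eventually_conj_iff)
  then have "at_right (0::real) = bot"
    unfolding bot by (metis filterlim_def filtermap_bot_iff bot.extremum_uniqueI)
  then show False by simp
qed

lemma HS_torus: "z \<in> torus \<Longrightarrow> HS S z = ereal (phiS S (logabs z))"
  by (simp add: HS_def)

text \<open>At a coordinate hyperplane the limsup of a continuous minorant is its value, so the
  bound extends without evaluating \<open>HS\<close> there.\<close>

lemma le_HS_if_continuous:
  fixes U :: "complex^'n \<Rightarrow> real"
  assumes "continuous_on UNIV U" "\<And>w. w \<in> torus \<Longrightarrow> U w \<le> phiS S (logabs w)"
  shows "ereal (U z) \<le> HS S z"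
proof (cases "z \<in> torus")
  case False
  have "((\<lambda>w. ereal (U w)) \<longlongrightarrow> ereal (U z)) (at z within torus)"
    using assms(1)
    by (intro tendsto_intros) (meson continuous_on_def continuous_on_subset iso_tuple_UNIV_I subset_UNIV tendsto_within_subset)
  then have "Limsup (at z within torus) (\<lambda>w. ereal (U w)) = ereal (U z)"
    by (rule lim_imp_Limsup[OF at_within_torus_neq_bot])
  moreover have "Limsup (at z within torus) (\<lambda>w. ereal (U w)) \<le>
      Limsup (at z within torus) (\<lambda>w. ereal (phiS S (logabs w)))"
    by (rule Limsup_mono) (simp add: eventually_at_filter assms(2))
  ultimately show ?thesis using False by (simp add: HS_def)
qed (simp add: HS_torus assms)

text \<open>The maximum sits inside the logarithm to keep its argument at least 1, which gives
  continuity across the coordinate hyperplanes.\<close>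

definition logplus :: "complex^'n \<Rightarrow> real^'n" where
  "logplus z = (\<chi> i. ln (max 1 (cmod (z $ i))))"

lemma continuous_on_logplus: "continuous_on A logplus"
  unfolding logplus_def by (intro continuous_intros) auto

lemma logplus_eq_posvec_logabs: "z \<in> torus \<Longrightarrow> logplus z = posvec (logabs z)"
  by (auto simp: vec_eq_iff logplus_def logabs_def torus_def max_def ln_ge_zero_iff)

lemma HS_eq_phiS_logplus:
  fixes S :: "(real^'n) set"
  assumes "compact S" "S \<noteq> {}" "S \<subseteq> nonneg_orthant" "lower_set S"
  shows "HS S z = ereal (phiS S (logplus z))"
proof -
  have eq: "phiS S (logabs w) = phiS S (logplus w)" if "w \<in> torus" for w
    using phiS_posvec_if_lower_set[OF assms, of "logabs w"] logplus_eq_posvec_logabs[OF that] by simp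
  show ?thesis
  proof (cases "z \<in> torus")
    case False
    have "continuous_on UNIV (\<lambda>w. ereal (phiS S (logplus w)))"
      by (intro continuous_intros continuous_on_compose2[OF continuous_on_phiS[OF assms(1,2)] continuous_on_logplus]) auto
    then have "((\<lambda>w. ereal (phiS S (logplus w))) \<longlongrightarrow> ereal (phiS S (logplus z))) (at z within torus)"
      by (meson continuous_on_def iso_tuple_UNIV_I subset_UNIV tendsto_within_subset)
    then have "Limsup (at z within torus) (\<lambda>w. ereal (phiS S (logplus w))) = ereal (phiS S (logplus z))"
      by (rule lim_imp_Limsup[OF at_within_torus_neq_bot])
    moreover have "Limsup (at z within torus) (\<lambda>w. ereal (phiS S (logplus w))) =
        Limsup (at z within torus) (\<lambda>w. ereal (phiS S (logabs w)))"
      by (rule Limsup_eq) (simp add: eventually_at_filter eq)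
    ultimately show ?thesis using False by (simp add: HS_def)
  qed (simp add: HS_torus eq)
qed

text \<open>Since \<open>max 1 (cmod a)\<close> is at least 1, the additive error
  \<open>cmod b\<close> costs at most a factor \<open>1 + cmod b\<close>, hence at most
  \<open>exp (cmod b)\<close>. The resulting Lipschitz constant 1 keeps extra factors out of
  (iv).\<close>

lemma ln_max_one_diff_le:
  fixes a b :: complex
  shows "ln (max 1 (cmod (a - b))) \<le> ln (max 1 (cmod a)) + cmod b"
proof -
  have "max 1 (cmod (a - b)) \<le> max 1 (cmod a) + cmod b"
    using norm_triangle_ineq4[of a b] norm_ge_zero[of b] by (auto simp: max_def simp del: norm_ge_zero)
  also have "\<dots> \<le> max 1 (cmod a) * (1 + cmod b)"
    using mult_right_mono[of 1 "max 1 (cmod a)" "cmod b"] by (simp add: algebra_simps)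
  also have "\<dots> \<le> max 1 (cmod a) * exp (cmod b)"
    by (intro mult_left_mono exp_ge_add_one_self) auto
  finally have "ln (max 1 (cmod (a - b))) \<le> ln (max 1 (cmod a) * exp (cmod b))"
    by (subst ln_le_cancel_iff) (auto intro: mult_pos_pos)
  also have "\<dots> = ln (max 1 (cmod a)) + cmod b" by (subst ln_mult) auto
  finally show ?thesis .
qed

lemma cmod_le_supnorm: "cmod (w $ i) \<le> supnorm w"
  unfolding supnorm_def by (rule Max_ge) auto

lemma HS_diff_le:
  fixes S :: "(real^'n) set"
  assumes "compact S" "S \<noteq> {}" "S \<subseteq> nonneg_orthant" "lower_set S"
  shows "HS S (z - w) \<le> ereal (phiS S onevec * supnorm w) + HS S z"
proof -
  have nonneg: "0 \<le> supnorm w" using cmod_le_supnorm[of w] norm_ge_zero order_trans by blast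
  \<comment> \<open>Each coordinate grows by at most \<open>supnorm w\<close>, so the change is
    dominated by a multiple of \<open>onevec\<close>; subadditivity then produces the constant
    \<open>phiS S onevec\<close>.\<close>
  have "phiS S (logplus (z - w)) \<le> phiS S (logplus z + supnorm w *\<^sub>R onevec)"
  proof (rule phiS_mono[OF assms(1-3)])
    fix i
    show "logplus (z - w) $ i \<le> (logplus z + supnorm w *\<^sub>R onevec) $ i"
      using ln_max_one_diff_le[of "z $ i" "w $ i"] cmod_le_supnorm[of w i]
      by (simp add: logplus_def onevec_def)
  qed
  also have "\<dots> \<le> phiS S (logplus z) + phiS S (supnorm w *\<^sub>R onevec)"
    by (rule phiS_add_le[OF assms(1,2)])
  also have "\<dots> \<le> phiS S (logplus z) + supnorm w * phiS S onevec"
    by (intro add_left_mono phiS_scaleR_le assms nonneg)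
  finally show ?thesis by (simp add: HS_eq_phiS_logplus[OF assms] mult.commute add.commute)
qed

section \<open>The witness functions\<close>

text \<open>This is the positive part of the pairing of s with log |z|, written so that continuity
  across the coordinate hyperplanes is visible. The product skips the indices j with s $ j = 0
  because 0 powr 0 = 0.\<close>

definition log_monomial :: "real^'n \<Rightarrow> complex^'n \<Rightarrow> real" where
  "log_monomial s z = ln (max 1 (\<Prod>j\<in>{j. 0 < s $ j}. cmod (z $ j) powr (s $ j)))"

lemma log_monomial_nonneg: "0 \<le> log_monomial s z"
  unfolding log_monomial_def by (rule ln_ge_zero) simp

lemma continuous_on_log_monomial: "continuous_on A (log_monomial s)"
  unfolding log_monomial_def
  by (intro continuous_on_ln continuous_on_max continuous_on_prod continuous_on_powr' continuous_intros) auto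

lemma log_monomial_eq:
  assumes "\<And>j. 0 \<le> s $ j" "\<And>j. 0 < s $ j \<Longrightarrow> z $ j \<noteq> 0"
  shows "log_monomial s z = max 0 (inner s (logabs z))"
proof -
  define P where "P = (\<Prod>j\<in>{j. 0 < s $ j}. cmod (z $ j) powr (s $ j))"
  have P: "P > 0" unfolding P_def using assms(2) by (intro prod_pos) auto
  have "ln P = (\<Sum>j\<in>{j. 0 < s $ j}. ln (cmod (z $ j) powr (s $ j)))"
    unfolding P_def using assms(2) by (subst ln_prod) auto
  also have "\<dots> = (\<Sum>j\<in>{j. 0 < s $ j}. s $ j * ln (cmod (z $ j)))"
    using assms(2) by (intro sum.cong) (auto simp: ln_powr)
  also have "\<dots> = (\<Sum>j\<in>UNIV. s $ j * ln (cmod (z $ j)))"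
    using assms(1) by (intro sum.mono_neutral_left) (auto simp: not_less order.antisym)
  finally have "ln P = inner s (logabs z)" by (simp add: inner_vec_def logabs_def)
  moreover have "ln (max 1 P) = max 0 (ln P)" using P by (auto simp: max_def)
  ultimately show ?thesis by (simp add: log_monomial_def P_def)
qed

text \<open>The positive part of the pairing is the larger of the pairings with \<open>s\<close> and
  with 0, and both points lie in \<open>S\<close>.\<close>

lemma log_monomial_le_phiS:
  fixes S :: "(real^'n) set"
  assumes "compact S" "S \<subseteq> nonneg_orthant" "0 \<in> S" "s \<in> S" "w \<in> torus"
  shows "log_monomial s w \<le> phiS S (logabs w)"
  using assms inner_le_phiS[OF assms(1,3), of "logabs w"] inner_le_phiS[OF assms(1,4), of "logabs w"]
  by (subst log_monomial_eq) (auto simp: nonneg_orthant_def torus_def)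

lemma log_monomial_le_HS:
  fixes S :: "(real^'n) set"
  assumes "compact S" "S \<subseteq> nonneg_orthant" "0 \<in> S" "s \<in> S"
  shows "ereal (log_monomial s w) \<le> HS S w"
  using log_monomial_le_phiS[OF assms] continuous_on_log_monomial by (intro le_HS_if_continuous)

section \<open>Growth of the witness along rays\<close>

definition expvec :: "real^'n \<Rightarrow> complex^'n" where
  "expvec \<xi> = (\<chi> i. of_real (exp (\<xi> $ i)))"

lemma HS_expvec: "HS S (expvec \<xi>) = ereal (phiS S \<xi>)"
proof -
  have "logabs (expvec \<xi>) = \<xi>" by (simp add: logabs_def expvec_def vec_eq_iff)
  then show ?thesis by (simp add: HS_def torus_def expvec_def)
qed

lemma le_if_nat_multiples_le:
  fixes a b c :: real
  assumes "\<And>n::nat. real n * a \<le> c + real n * b"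
  shows "a \<le> b"
proof (rule ccontr)
  assume "\<not> a \<le> b"
  then obtain n :: nat where "real n * (a - b) > c"
    using reals_Archimedean3[of "a - b"] by auto
  then show False using assms[of n] by (simp add: algebra_simps)
qed

text \<open>On the points with logabs = n \<xi>, the coordinates with negative \<xi> $ j tend to 0. Shifting
  them by 1 replaces \<xi> by its positive part in the growth rate of the witness, but not in that
  of HS.\<close>

lemma phiS_posvec_if_translates_bounded:
  fixes S :: "(real^'n) set"
  assumes "compact S" "S \<noteq> {}" "S \<subseteq> nonneg_orthant"
    and bound: "\<And>s w. s \<in> S \<Longrightarrow> \<exists>c::real. \<forall>z. ereal (log_monomial s (z - w)) \<le> ereal c + HS S z"
  shows "phiS S \<xi> = phiS S (posvec \<xi>)"
proof (rule antisym)
  show "phiS S \<xi> \<le> phiS S (posvec \<xi>)"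
    using assms by (intro phiS_mono) auto
  show "phiS S (posvec \<xi>) \<le> phiS S \<xi>"
    unfolding phiS_le_iff[OF assms(1,2)]
  proof
    fix s assume s: "s \<in> S"
    \<comment> \<open>The entry -1 makes the shifted coordinate
      \<open>exp (n * \<xi> $ i) + 1\<close>, whose logarithm is nonnegative for every n.\<close>
    define w :: "complex^'n" where "w = (\<chi> i. if \<xi> $ i < 0 then - 1 else 0)"
    obtain c where c: "\<And>z. ereal (log_monomial s (z - w)) \<le> ereal c + HS S z"
      using bound[OF s] by blast
    show "inner s (posvec \<xi>) \<le> phiS S \<xi>"
    proof (rule le_if_nat_multiples_le)
      fix n :: nat
      define z where "z = expvec (real n *\<^sub>R \<xi>)"
      have coord: "max (real n * \<xi> $ i) 0 \<le> ln (cmod ((z - w) $ i)) \<and> (z - w) $ i \<noteq> 0" for i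
      proof (cases "\<xi> $ i < 0")
        case True
        have "(z - w) $ i = complex_of_real (exp (real n * \<xi> $ i) + 1)"
          using True by (simp add: z_def w_def expvec_def)
        moreover have "cmod (complex_of_real (exp (real n * \<xi> $ i) + 1)) = exp (real n * \<xi> $ i) + 1"
          by (subst norm_of_real) (simp add: add_pos_pos less_imp_le)
        moreover have "ln (exp (real n * \<xi> $ i) + 1) \<ge> 0" by (intro ln_ge_zero) simp
        ultimately show ?thesis using True
          by (metis add_nonneg_pos exp_ge_zero linorder_not_less max.absorb2 mult_nonneg_nonpos
              norm_eq_zero norm_ge_zero of_nat_0_le_iff order_less_imp_le zero_less_one less_irrefl)
      next
        case False
        then show ?thesis by (simp add: z_def w_def expvec_def)
      qed
      have "real n * inner s (posvec \<xi>) = inner s (real n *\<^sub>R posvec \<xi>)" by simp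
      also have "\<dots> \<le> inner s (logabs (z - w))"
      proof (rule inner_mono_nonneg)
        show "0 \<le> s $ i" for i using s assms(3) by (auto simp: nonneg_orthant_def)
        show "(real n *\<^sub>R posvec \<xi>) $ i \<le> logabs (z - w) $ i" for i
          using coord[of i] max_mult_distrib_left[of "real n" "\<xi> $ i" 0] by (simp add: logabs_def)
      qed
      also have "\<dots> \<le> log_monomial s (z - w)"
        using s assms(3) coord by (subst log_monomial_eq) (auto simp: nonneg_orthant_def)
      also have "\<dots> \<le> c + phiS S (real n *\<^sub>R \<xi>)"
        using c[of z] by (simp add: z_def HS_expvec)
      also have "\<dots> \<le> c + real n * phiS S \<xi>"
        by (intro add_left_mono phiS_scaleR_le assms) simp
      finally show "real n * inner s (posvec \<xi>) \<le> c + real n * phiS S \<xi>" .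
    qed
  qed
qed

section \<open>Mean values of logarithms over circles\<close>

text \<open>This is the mean value property of the real part of \<open>Ln (1 + a * u)\<close>. For
  \<open>cmod a < 1\<close> the closed unit disc is mapped into the right half-plane, where the
  principal branch is holomorphic, and the value at the centre is 0.\<close>

lemma has_integral_ln_cmod_one_plus:
  fixes a :: complex
  assumes "cmod a < 1"
  shows "((\<lambda>\<theta>. ln (cmod (1 + a * cis \<theta>))) has_integral 0) {0..2*pi}"
proof -
  define f where "f = (\<lambda>u. Ln (1 + a * u))"
  have re: "0 < Re (1 + a * u)" if "cmod u \<le> 1" for u
  proof -
    have "cmod (a * u) \<le> cmod a" using that by (simp add: norm_mult mult_left_le)
    moreover have "- Re (a * u) \<le> cmod (a * u)"
      using abs_Re_le_cmod[of "a * u"] by linarith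
    ultimately show ?thesis using assms by simp
  qed
  have nonpos: "1 + a * u \<notin> \<real>\<^sub>\<le>\<^sub>0" if "cmod u \<le> 1" for u
    using re[OF that] complex_nonpos_Reals_iff by force
  have "f holomorphic_on cball 0 1"
    unfolding f_def using nonpos by (intro holomorphic_intros) auto
  then have "((\<lambda>u. f u / (u - 0)) has_contour_integral 2 * of_real pi * \<i> * f 0) (circlepath 0 1)"
    by (rule Cauchy_integral_circlepath_simple) simp
  then have "((\<lambda>x. f (exp (2 * of_real pi * \<i> * of_real x)) * (2 * of_real pi * \<i>)) has_integral 0) {0..1}"
    unfolding has_contour_integral vector_derivative_circlepath
    by (rule has_integral_eq[rotated, where s = "{0..1}", THEN has_integral_eq_rhs])
       (auto simp: circlepath f_def)
  \<comment> \<open>Dividing by u has cancelled the exponential in the derivative of the path. The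
    factor \<open>\<i>\<close> remains, so imaginary parts extract the real part of the
    logarithm.\<close>
  then have "((\<lambda>x. 2 * pi * Im (\<i> * f (exp (2 * of_real pi * \<i> * of_real x)))) has_integral 0) {0..1}"
    by (drule_tac has_integral_Im) (simp add: algebra_simps)
  then have *: "((\<lambda>x. 2 * pi * ln (cmod (1 + a * cis (2 * pi * x)))) has_integral 0) {0..1}"
  proof (rule has_integral_eq[rotated])
    fix x :: real
    have "exp (2 * of_real pi * \<i> * of_real x) = cis (2 * pi * x)"
      by (simp add: cis_conv_exp algebra_simps)
    moreover have "1 + a * cis (2 * pi * x) \<noteq> 0" using re[of "cis (2 * pi * x)"] by force
    ultimately show "2 * pi * Im (\<i> * f (exp (2 * of_real pi * \<i> * of_real x))) =
        2 * pi * ln (cmod (1 + a * cis (2 * pi * x)))"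
      by (simp add: f_def)
  qed
  have "((\<lambda>\<theta>. 2 * pi * ln (cmod (1 + a * cis (2 * pi * ((1 / (2 * pi)) *\<^sub>R \<theta> + 0))))) has_integral
      0 /\<^sub>R (1 / (2 * pi)) ^ DIM(real)) (cbox ((0 - 0) /\<^sub>R (1 / (2 * pi))) ((1 - 0) /\<^sub>R (1 / (2 * pi))))"
    by (rule has_integral_affinity') (use * in auto)
  then have "((\<lambda>\<theta>. 2 * pi * ln (cmod (1 + a * cis \<theta>))) has_integral 0) {0..2*pi}"
    by simp
  from has_integral_mult_right[OF this, of "1 / (2*pi)"] show ?thesis by simp
qed

text \<open>By Jensen's formula for a linear polynomial the mean is the logarithm of the larger of
  the two moduli; factoring out that coefficient reduces to the previous integral. Equal moduli
  would put the zero on the circle.\<close>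

lemma ln_cmod_le_circle_mean:
  fixes A B :: complex
  assumes "A \<noteq> 0" "cmod A \<noteq> cmod B"
  obtains I where "((\<lambda>\<theta>. ln (cmod (A + B * cis \<theta>))) has_integral I) {0..2*pi}" "2 * pi * ln (cmod A) \<le> I"
proof (cases "cmod B < cmod A")
  case True
  have "((\<lambda>\<theta>. ln (cmod A) + ln (cmod (1 + B / A * cis \<theta>))) has_integral 2 * pi * ln (cmod A) + 0) {0..2*pi}"
    using True has_integral_const_real[of "ln (cmod A)" 0 "2*pi"]
    by (intro has_integral_add has_integral_ln_cmod_one_plus) (auto simp: norm_divide divide_simps assms)
  moreover have "ln (cmod A) + ln (cmod (1 + B / A * cis \<theta>)) = ln (cmod (A + B * cis \<theta>))" for \<theta>
  proof -
    have "cmod (B / A * cis \<theta>) < 1" using True assms(1) by (simp add: norm_mult norm_divide)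
    then have "1 + B / A * cis \<theta> \<noteq> 0"
      by (metis add_eq_0_iff less_irrefl norm_minus_cancel norm_one)
    moreover have "A + B * cis \<theta> = A * (1 + B / A * cis \<theta>)" using assms(1) by (simp add: field_simps)
    ultimately show ?thesis using assms(1) by (simp add: norm_mult ln_mult)
  qed
  ultimately show ?thesis using that by force
next
  case False
  then have lt: "cmod A < cmod B" using assms(2) by simp
  then have B: "B \<noteq> 0" by force
  \<comment> \<open>Factoring out \<open>B * cis \<theta>\<close> leaves the angle
    \<open>- \<theta>\<close>; conjugation reverses it without changing the modulus.\<close>
  have "((\<lambda>\<theta>. ln (cmod B) + ln (cmod (1 + cnj (A / B) * cis \<theta>))) has_integral 2 * pi * ln (cmod B) + 0) {0..2*pi}"
    using lt B has_integral_const_real[of "ln (cmod B)" 0 "2*pi"]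
    by (intro has_integral_add has_integral_ln_cmod_one_plus) (auto simp: norm_divide divide_simps)
  moreover have "ln (cmod B) + ln (cmod (1 + cnj (A / B) * cis \<theta>)) = ln (cmod (A + B * cis \<theta>))" for \<theta>
  proof -
    have "cmod (cnj (A / B) * cis \<theta>) < 1" using lt B by (simp add: norm_mult norm_divide)
    then have "1 + cnj (A / B) * cis \<theta> \<noteq> 0"
      by (metis add_eq_0_iff less_irrefl norm_minus_cancel norm_one)
    moreover have "cmod (1 + cnj (A / B) * cis \<theta>) = cmod (1 + A / B * cis (- \<theta>))"
      by (subst complex_mod_cnj[symmetric]) (simp add: cis_cnj)
    moreover have "A + B * cis \<theta> = B * cis \<theta> * (1 + A / B * cis (- \<theta>))"
      using B by (simp add: field_simps cis_mult)
    moreover have "1 + A / B * cis (- \<theta>) \<noteq> 0" using calculation(1,2) by (metis norm_eq_zero)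
    ultimately show ?thesis using B by (simp add: norm_mult ln_mult)
  qed
  moreover have "ln (cmod A) \<le> ln (cmod B)" using lt assms(1) B by simp
  ultimately show ?thesis using that[of "2 * pi * ln (cmod B)"] by force
qed

section \<open>Plurisubharmonicity of the witness\<close>

lemma ereal_integral_nonneg_continuous:
  fixes f :: "real \<Rightarrow> real"
  assumes "continuous_on {a..b} f" "\<And>x. 0 \<le> f x"
  shows "ereal_integral (lebesgue_on {a..b}) (\<lambda>x. ereal (f x)) = ereal (integral {a..b} f)"
proof -
  have int: "integrable (lebesgue_on {a..b}) f"
    by (rule continuous_imp_integrable_real[OF assms(1)])
  have "(\<integral>\<^sup>+ x. e2ennreal (ereal (f x)) \<partial>lebesgue_on {a..b}) = ennreal (integral {a..b} f)"
    using nn_integral_eq_integral[OF int] assms(2) lebesgue_integral_eq_integral[OF int] by (simp add: ennreal.abs_eq flip: ennreal.abs_eq)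
  moreover have "(\<integral>\<^sup>+ x. e2ennreal (- ereal (f x)) \<partial>lebesgue_on {a..b}) = 0"
    using assms(2) by (simp add: ennreal_neg)
  moreover have "integral {a..b} f \<ge> 0"
    by (rule integral_nonneg) (use assms integrable_continuous_real in auto)
  ultimately show ?thesis by (simp add: ereal_integral_def zero_ennreal.rep_eq)
qed

text \<open>The one-variable inequalities are added with the nonnegative weights
  \<open>s $ j\<close>, and the pairing is then bounded pointwise by its positive part. The
  condition on moduli keeps every coordinate nonzero along the circle.\<close>

lemma log_monomial_le_circle_mean_generic:
  fixes A B :: "complex^'n"
  assumes s: "\<And>j. 0 \<le> s $ j" and A: "\<And>j. 0 < s $ j \<Longrightarrow> A $ j \<noteq> 0"
    and AB: "\<And>j. cmod (A $ j) \<noteq> cmod (B $ j)"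
  shows "2 * pi * inner s (logabs A) \<le> integral {0..2*pi} (\<lambda>\<theta>. log_monomial s (A + cis \<theta> *s B))"
proof -
  have "\<exists>I. ((\<lambda>\<theta>. s $ j * ln (cmod (A $ j + B $ j * cis \<theta>))) has_integral s $ j * I) {0..2*pi} \<and>
      s $ j * (2 * pi * ln (cmod (A $ j))) \<le> s $ j * I" for j
  proof (cases "s $ j = 0")
    case False
    then have "A $ j \<noteq> 0" using A[of j] s[of j] by linarith
    from ln_cmod_le_circle_mean[OF this AB] show ?thesis
      using has_integral_mult_right mult_left_mono[OF _ s[of j]] by metis
  qed auto
  then obtain I where I: "\<And>j. ((\<lambda>\<theta>. s $ j * ln (cmod (A $ j + B $ j * cis \<theta>))) has_integral s $ j * I j) {0..2*pi}"
     "\<And>j. s $ j * (2 * pi * ln (cmod (A $ j))) \<le> s $ j * I j"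
    by metis
  have "2 * pi * inner s (logabs A) = (\<Sum>j\<in>UNIV. s $ j * (2 * pi * ln (cmod (A $ j))))"
    by (simp add: inner_vec_def logabs_def sum_distrib_left mult_ac)
  also have "\<dots> \<le> (\<Sum>j\<in>UNIV. s $ j * I j)" by (intro sum_mono I)
  also have "\<dots> \<le> integral {0..2*pi} (\<lambda>\<theta>. log_monomial s (A + cis \<theta> *s B))"
  proof (rule has_integral_le)
    show "((\<lambda>\<theta>. \<Sum>j\<in>UNIV. s $ j * ln (cmod (A $ j + B $ j * cis \<theta>))) has_integral (\<Sum>j\<in>UNIV. s $ j * I j)) {0..2*pi}"
      by (intro has_integral_sum I) auto
    show "((\<lambda>\<theta>. log_monomial s (A + cis \<theta> *s B)) has_integral
        integral {0..2*pi} (\<lambda>\<theta>. log_monomial s (A + cis \<theta> *s B))) {0..2*pi}"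
      unfolding vector_scalar_mult_def
      by (intro integrable_integral integrable_continuous_real
          continuous_on_compose2[OF continuous_on_log_monomial[of UNIV]] continuous_intros) auto
    fix \<theta> :: real
    have ne: "(A + cis \<theta> *s B) $ j \<noteq> 0" for j
    proof
      assume "(A + cis \<theta> *s B) $ j = 0"
      then have "A $ j = - (cis \<theta> * B $ j)" by (simp add: eq_neg_iff_add_eq_0)
      then show False using AB[of j] by (simp add: norm_mult)
    qed
    have "(\<Sum>j\<in>UNIV. s $ j * ln (cmod (A $ j + B $ j * cis \<theta>))) = inner s (logabs (A + cis \<theta> *s B))"
      by (simp add: inner_vec_def logabs_def mult.commute)
    also have "\<dots> \<le> log_monomial s (A + cis \<theta> *s B)"
      using ne s by (subst log_monomial_eq) auto
    finally show "(\<Sum>j\<in>UNIV. s $ j * ln (cmod (A $ j + B $ j * cis \<theta>))) \<le> log_monomial s (A + cis \<theta> *s B)" .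
  qed
  finally show ?thesis .
qed

lemma log_monomial_le_circle_mean:
  fixes A B :: "complex^'n"
  assumes s: "\<And>j. 0 \<le> s $ j" and r: "r > 0"
  shows "2 * pi * log_monomial s A \<le> integral {0..2*pi} (\<lambda>\<theta>. log_monomial s (A + (of_real r * cis \<theta>) *s B))"
    (is "_ \<le> ?F r")
proof -
  have cont: "continuous_on UNIV (\<lambda>r::real. ?F r)"
    unfolding vector_scalar_mult_def interval_cbox
    by (intro integral_continuous_on_param)
       (auto simp: split_beta intro!: continuous_on_compose2[OF continuous_on_log_monomial[of UNIV]] continuous_intros)
  have nonneg: "?F r \<ge> 0"
    by (intro integral_nonneg log_monomial_nonneg integrable_continuous_real
        continuous_on_compose2[OF continuous_on_log_monomial[of UNIV]])
       (auto simp: vector_scalar_mult_def intro!: continuous_intros)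
  show ?thesis
  \<comment> \<open>If the witness vanishes at the centre, nonnegativity of the mean is enough.
    Otherwise every coordinate of positive weight is nonzero and the witness equals the
    pairing.\<close>
  proof (cases "log_monomial s A = 0")
    case False
    have A: "A $ j \<noteq> 0" if "0 < s $ j" for j
    proof
      assume "A $ j = 0"
      then have zero: "(\<Prod>j\<in>{j. 0 < s $ j}. cmod (A $ j) powr (s $ j)) = 0"
        using that by (intro prod_zero) auto
      have "log_monomial s A = 0" unfolding log_monomial_def zero by simp
      then show False using False by simp
    qed
    \<comment> \<open>Coordinates of weight 0 may vanish in \<open>A\<close>. Replacing them by 1
      leaves the witness unchanged and keeps the moduli distinct where
      \<open>B $ j = 0\<close>.\<close>
    define A' where "A' = (\<chi> j. if s $ j = 0 then 1 else A $ j)"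
    \<comment> \<open>At these radii the circle may meet a coordinate hyperplane. They are finite in
      number, so good radii accumulate at \<open>r\<close>. If \<open>B $ j = 0\<close> the quotient
      is 0, which is not a positive radius.\<close>
    define bad where "bad = (\<lambda>j. cmod (A' $ j) / cmod (B $ j)) ` UNIV"
    have A'0: "A' $ j \<noteq> 0" for j using A[of j] s[of j] by (auto simp: A'_def)
    have eq: "log_monomial s (A' + w *s B) = log_monomial s (A + w *s B)" for w
      unfolding log_monomial_def A'_def by (intro arg_cong[where f = ln] arg_cong[where f = "max 1"] prod.cong) auto
    have "\<forall>\<^sub>F t in at r. t \<notin> bad \<and> t > 0"
    proof (intro eventually_conj)
      have "finite bad" by (simp add: bad_def)
      then show "\<forall>\<^sub>F t in at r. t \<notin> bad"
        using islimpt_finite islimpt_iff_eventually by blast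
      show "\<forall>\<^sub>F t in at r. t > 0" using order_tendstoD(1)[OF tendsto_ident_at r] .
    qed
    then have "\<forall>\<^sub>F t in at r. 2 * pi * inner s (logabs A') \<le> ?F t"
    proof (rule eventually_mono)
      fix t assume t: "t \<notin> bad \<and> t > 0"
      have "2 * pi * inner s (logabs A') \<le> integral {0..2*pi} (\<lambda>\<theta>. log_monomial s (A' + cis \<theta> *s (of_real t *s B)))"
      proof (rule log_monomial_le_circle_mean_generic[OF s A'0])
        fix j show "cmod (A' $ j) \<noteq> cmod ((of_real t *s B) $ j)"
        proof (cases "B $ j = 0")
          case False
          moreover have "t \<noteq> cmod (A' $ j) / cmod (B $ j)" using t unfolding bad_def by blast
          ultimately show ?thesis using t by (auto simp: norm_mult field_simps)
        qed (use A'0 in auto)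
      qed
      moreover have comm: "cis \<theta> *s (of_real t *s B) = (of_real t * cis \<theta>) *s B" for \<theta>
        by (simp add: mult.commute)
      ultimately show "2 * pi * inner s (logabs A') \<le> ?F t" by (simp only: comm eq)
    qed
    moreover have "(?F \<longlongrightarrow> ?F r) (at r)"
      using cont by (simp add: continuous_on_def)
    ultimately have "2 * pi * inner s (logabs A') \<le> ?F r"
      by (intro tendsto_lowerbound) auto
    moreover have "inner s (logabs A') = inner s (logabs A)"
      unfolding inner_vec_def by (intro sum.cong) (auto simp: A'_def logabs_def)
    moreover have "log_monomial s A = inner s (logabs A)"
      using log_monomial_eq[OF s A] False by (auto simp: max_def split: if_splits)
    ultimately show ?thesis by simp
  qed (use nonneg in simp)
qed

lemma log_monomial_in_LS:
  fixes S :: "(real^'n) set"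
  assumes "compact S" "S \<subseteq> nonneg_orthant" "0 \<in> S" "s \<in> S"
  shows "(\<lambda>z. ereal (log_monomial s z)) \<in> LS S"
proof -
  have s: "\<And>j. 0 \<le> s $ j" using assms by (auto simp: nonneg_orthant_def)
  have "usc (\<lambda>z. ereal (log_monomial s z))"
    unfolding usc_def
  proof (intro allI impI)
    fix z and c :: ereal assume "ereal (log_monomial s z) < c"
    moreover have "((\<lambda>w. ereal (log_monomial s w)) \<longlongrightarrow> ereal (log_monomial s z)) (at z)"
      using continuous_on_log_monomial[of UNIV s] by (intro tendsto_intros) (simp add: continuous_on_def)
    ultimately show "\<forall>\<^sub>F w in at z. ereal (log_monomial s w) < c" by (rule order_tendstoD(2)[rotated])
  qed
  moreover have "ereal (log_monomial s (a + \<zeta> *s b)) \<le> ereal (1 / (2*pi)) *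
      ereal_integral (lebesgue_on {0..2*pi}) (\<lambda>\<theta>. ereal (log_monomial s (a + (\<zeta> + of_real r * cis \<theta>) *s b)))"
    if "r > 0" for a b \<zeta> r
  proof -
    have "ereal_integral (lebesgue_on {0..2*pi}) (\<lambda>\<theta>. ereal (log_monomial s (a + (\<zeta> + of_real r * cis \<theta>) *s b)))
      = ereal (integral {0..2*pi} (\<lambda>\<theta>. log_monomial s (a + (\<zeta> + of_real r * cis \<theta>) *s b)))"
      by (intro ereal_integral_nonneg_continuous log_monomial_nonneg
        continuous_on_compose2[OF continuous_on_log_monomial[of UNIV]])
       (auto simp: vector_scalar_mult_def intro!: continuous_intros)
    moreover have "2 * pi * log_monomial s (a + \<zeta> *s b) \<le>
      integral {0..2*pi} (\<lambda>\<theta>. log_monomial s (a + (\<zeta> + of_real r * cis \<theta>) *s b))"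
      using log_monomial_le_circle_mean[OF s that, where A = "a + \<zeta> *s b" and B = b]
      by (simp add: vector_sadd_rdistrib add.assoc)
    ultimately show ?thesis by (simp add: field_simps)
  qed
  moreover have "ereal (log_monomial s z) \<le> ereal 0 + HS S z" for z
    using log_monomial_le_HS[OF assms] by simp
  ultimately show ?thesis by (auto simp: LS_def psh_def intro!: exI[of _ 0])
qed

section \<open>Existence of mollifiers\<close>

lemma Ck_imp_continuous: "Ck k f \<Longrightarrow> continuous_on UNIV f"
  by (cases k) auto

text \<open>\<open>Ck\<close> refers to the chosen \<open>frechet_derivative\<close>; uniqueness of
  derivatives lets an explicit formula take its place.\<close>

lemma Ck_SucI:
  assumes "\<And>x. (f has_derivative D x) (at x)" "\<And>b. b \<in> Basis \<Longrightarrow> Ck k (\<lambda>x. D x b)"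
  shows "Ck (Suc k) f"
proof -
  have "frechet_derivative f (at x) = D x" for x
    using frechet_derivative_at[OF assms(1)[of x]] by simp
  moreover have "continuous_on UNIV f"
    using assms(1) by (auto simp: continuous_on_eq_continuous_at intro: has_derivative_continuous)
  ultimately show ?thesis using assms by (auto simp: differentiable_def)
qed

lemma Ck_SucD:
  assumes "Ck (Suc k) f"
  shows "(f has_derivative frechet_derivative f (at x)) (at x)"
    "b \<in> Basis \<Longrightarrow> Ck k (\<lambda>x. frechet_derivative f (at x) b)"
  using assms by (auto simp: frechet_derivative_works)

lemma Ck_Suc_imp_Ck: "Ck (Suc k) f \<Longrightarrow> Ck k f"
  by (induction k arbitrary: f) auto

lemma Ck_const: "Ck k (\<lambda>x::'a::euclidean_space. c)"
proof (induction k arbitrary: c)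
  case (Suc k)
  show ?case by (rule Ck_SucI[where D = "\<lambda>_ _. 0"]) (auto intro: Suc)
qed simp

lemma Ck_add: "Ck k f \<Longrightarrow> Ck k g \<Longrightarrow> Ck k (\<lambda>x. f x + g x)"
proof (induction k arbitrary: f g)
  case (Suc k)
  show ?case
    by (rule Ck_SucI[OF has_derivative_add[OF Ck_SucD(1)[OF Suc.prems(1)] Ck_SucD(1)[OF Suc.prems(2)]]])
       (intro Suc.IH Ck_SucD(2)[OF Suc.prems(1)] Ck_SucD(2)[OF Suc.prems(2)])
qed (auto intro: continuous_intros)

lemma Ck_mult: "Ck k f \<Longrightarrow> Ck k g \<Longrightarrow> Ck k (\<lambda>x. f x * g x)"
proof (induction k arbitrary: f g)
  case (Suc k)
  show ?case
    by (rule Ck_SucI[OF has_derivative_mult[OF Ck_SucD(1)[OF Suc.prems(1)] Ck_SucD(1)[OF Suc.prems(2)]]])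
       (intro Ck_add Suc.IH Ck_SucD(2)[OF Suc.prems(1)] Ck_SucD(2)[OF Suc.prems(2)]
         Ck_Suc_imp_Ck[OF Suc.prems(1)] Ck_Suc_imp_Ck[OF Suc.prems(2)])
qed (auto intro: continuous_intros)

lemma Ck_inner: "Ck k (\<lambda>x::'a::euclidean_space. inner x b)"
proof (cases k)
  case (Suc m)
  show ?thesis unfolding Suc
    by (rule Ck_SucI[OF has_derivative_inner_left[OF has_derivative_ident]]) (rule Ck_const)
qed (auto intro: continuous_intros)

text \<open>The span of these functions is closed under differentiation, which is what makes the
  induction on the order of smoothness of the bump go through.\<close>

definition flat_exp :: "nat \<Rightarrow> real \<Rightarrow> real" where
  "flat_exp k t = (if t > 0 then inverse t ^ k * exp (- inverse t) else 0)"

text \<open>This is the difference quotient at 0, where the two branches meet. On the right,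
  substituting 1/h reduces it to the exponential outgrowing a power.\<close>

lemma flat_exp_div_tendsto_0: "((\<lambda>h. flat_exp k h / h) \<longlongrightarrow> 0) (at 0)"
proof (rule filterlim_split_at)
  show "((\<lambda>h. flat_exp k h / h) \<longlongrightarrow> 0) (at_left 0)"
    by (rule tendsto_eventually) (auto simp: flat_exp_def eventually_at_filter)
  have "((\<lambda>x::real. x ^ Suc k / exp x) \<longlongrightarrow> 0) at_top" by (rule tendsto_power_div_exp_0)
  then have "((\<lambda>h::real. inverse h ^ Suc k / exp (inverse h)) \<longlongrightarrow> 0) (at_right 0)"
    by (rule filterlim_compose[OF _ filterlim_inverse_at_top_right])
  then show "((\<lambda>h. flat_exp k h / h) \<longlongrightarrow> 0) (at_right 0)"
    by (rule Lim_transform_eventually)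
       (auto simp: flat_exp_def eventually_at_filter exp_minus divide_inverse)
qed

lemma flat_exp_has_field_derivative:
  "(flat_exp k has_field_derivative (- real k * flat_exp (Suc k) t + flat_exp (Suc (Suc k)) t)) (at t)"
proof -
  consider "t < 0" | "t = 0" | "t > 0" by linarith
  then show ?thesis
  proof cases
    case 1
    have "((\<lambda>_. 0) has_field_derivative 0) (at t)" by simp
    moreover have "\<forall>\<^sub>F x in nhds t. flat_exp k x = 0"
      using eventually_nhds_in_open[of "{..<0}" t] 1 by (auto simp: flat_exp_def elim!: eventually_mono)
    ultimately show ?thesis using 1
      by (subst DERIV_cong_ev[where g = "\<lambda>_. 0" and y = t]) (auto simp: flat_exp_def)
  next
    case 2
    then show ?thesis
      using flat_exp_div_tendsto_0[of k] by (simp add: has_field_derivative_iff flat_exp_def)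
  next
    case 3
    \<comment> \<open>For k = 0 the subtraction \<open>k - 1\<close> truncates, but its coefficient
      is 0; the conversion below therefore splits on k.\<close>
    have "((\<lambda>t. inverse t ^ k * exp (- inverse t)) has_field_derivative
        (real k * inverse t ^ (k - 1) * (- (inverse t)\<^sup>2)) * exp (- inverse t) +
        inverse t ^ k * (exp (- inverse t) * (inverse t)\<^sup>2)) (at t)"
      using 3 by (auto intro!: derivative_eq_intros simp: power2_eq_square)
    then have "((\<lambda>t. inverse t ^ k * exp (- inverse t)) has_field_derivative
        (- real k * flat_exp (Suc k) t + flat_exp (Suc (Suc k)) t)) (at t)"
      using 3 by (cases k) (simp_all add: flat_exp_def power2_eq_square algebra_simps)
    moreover have "\<forall>\<^sub>F x in nhds t. flat_exp k x = inverse x ^ k * exp (- inverse x)"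
      using eventually_nhds_in_open[of "{0<..}" t] 3 by (auto simp: flat_exp_def elim!: eventually_mono)
    ultimately show ?thesis
      by (subst DERIV_cong_ev[where g = "\<lambda>t. inverse t ^ k * exp (- inverse t)" and y = t]) auto
  qed
qed

text \<open>The index \<open>m\<close> stays arbitrary because differentiation raises it by one and
  by two. The squared norm is radial and polynomial, hence smooth at the origin too.\<close>

lemma Ck_bump: "Ck k (\<lambda>x::'a::euclidean_space. flat_exp m (1 - inner x x))"
proof (induction k arbitrary: m)
  case 0
  have "continuous_on UNIV (flat_exp m)"
    by (meson DERIV_continuous_on DERIV_subset flat_exp_has_field_derivative subset_UNIV)
  then show ?case
    by (auto intro!: continuous_on_compose2[of UNIV "flat_exp m"] continuous_intros)
next
  case (Suc k)
  define D where "D = (\<lambda>(x::'a) b. (- real m * flat_exp (Suc m) (1 - inner x x) +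
      flat_exp (Suc (Suc m)) (1 - inner x x)) * (- 2 * inner x b))"
  show ?case
  proof (rule Ck_SucI)
    fix x :: 'a
    have "((\<lambda>x. 1 - inner x x) has_derivative (\<lambda>b. - 2 * inner x b)) (at x)"
      by (auto intro!: derivative_eq_intros simp: inner_commute)
    from has_derivative_compose[OF this flat_exp_has_field_derivative[unfolded has_field_derivative_def]]
    show "((\<lambda>x. flat_exp m (1 - inner x x)) has_derivative D x) (at x)"
      by (simp add: D_def)
  next
    fix b :: 'a
    show "Ck k (\<lambda>x. D x b)"
      unfolding D_def by (intro Ck_mult Ck_add Ck_const Ck_inner Suc.IH)
  qed
qed

lemma continuous_bounded_support_integrable:
  fixes f :: "'a::euclidean_space \<Rightarrow> real"
  assumes "continuous_on UNIV f" "bounded {x. f x \<noteq> 0}"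
  shows "integrable lborel f"
proof -
  obtain a where a: "{x. f x \<noteq> 0} \<subseteq> cbox (-a) a"
    using bounded_subset_cbox_symmetric[OF assms(2)] by blast
  have "integrable lborel (\<lambda>x. indicator (cbox (-a) a) x *\<^sub>R f x)"
    by (rule borel_integrable_compact) (auto intro: continuous_on_subset[OF assms(1)])
  also have "(\<lambda>x. indicator (cbox (-a) a) x *\<^sub>R f x) = f"
    using a by (auto simp: indicator_def fun_eq_iff)
  finally show ?thesis .
qed

text \<open>Condition (vi) would be vacuous without a mollifier, so its converse needs an actual
  one: the normalized bump.\<close>

lemma ex_mollifier: "\<exists>\<psi> :: complex^'n \<Rightarrow> real. mollifier \<psi>"
proof -
  define f :: "complex^'n \<Rightarrow> real" where "f = (\<lambda>x. flat_exp 0 (1 - inner x x))"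
  define c where "c = integral\<^sup>L lborel f"
  have cont: "continuous_on UNIV f"
    unfolding f_def by (rule Ck_imp_continuous[OF Ck_bump])
  have nz: "f x \<noteq> 0 \<longleftrightarrow> norm x < 1" for x
    by (simp add: f_def flat_exp_def power2_norm_eq_inner[symmetric] abs_square_less_1)
  have nonneg: "0 \<le> f x" for x by (simp add: f_def flat_exp_def)
  have bdd: "bounded {x. f x \<noteq> 0}" unfolding nz bounded_iff by (auto intro!: exI[of _ 1])
  have int: "integrable lborel f" by (rule continuous_bounded_support_integrable[OF cont bdd])
  have "c \<noteq> 0"
  proof
    assume "c = 0"
    then have "AE x in lborel. f x = 0"
      using integral_nonneg_eq_0_iff_AE[OF int] nonneg by (simp add: c_def)
    then have "AE x in lborel. x \<notin> ball (0::complex^'n) 1" by (rule eventually_mono) (use nz in auto)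
    then have "emeasure lborel (ball (0::complex^'n) 1) = 0"
      by (subst (asm) AE_iff_measurable[where N = "ball 0 1"]) auto
    moreover have "emeasure lborel (ball (0::complex^'n) 1) \<noteq> 0"
      using open_not_negligible[of "ball (0::complex^'n) 1"]
      by (auto simp: negligible_iff_emeasure0)
    ultimately show False by simp
  qed
  moreover have "c \<ge> 0" unfolding c_def using nonneg by simp
  ultimately have c: "c > 0" by simp
  have "mollifier (\<lambda>x. inverse c * f x)"
    unfolding mollifier_def smooth_def
  proof (intro conjI allI impI)
    show "Ck k (\<lambda>x. inverse c * f x)" for k
      unfolding f_def by (intro Ck_mult Ck_const Ck_bump)
    show "bounded {\<zeta>. inverse c * f \<zeta> \<noteq> 0}" using bdd c by simp
    show "inverse c * f \<zeta> = inverse c * f \<eta>" if "norm \<zeta> = norm \<eta>" for \<zeta> \<eta>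
      using that by (simp add: f_def power2_norm_eq_inner[symmetric])
    show "0 \<le> inverse c * f x" for x using c nonneg by simp
    show "integral\<^sup>L lborel (\<lambda>x. inverse c * f x) = 1" using c by (simp flip: c_def)
  qed
  then show ?thesis by blast
qed

section \<open>Extended real integrals\<close>

text \<open>The splitting of x into positive and negative part is rearranged so that all terms are
  nonnegative; no undefined difference occurs even at -infinity.\<close>

lemma e2ennreal_bound_split:
  assumes "x \<le> ereal K" "0 \<le> K"
  shows "e2ennreal (ereal K - x) + e2ennreal x = ennreal K + e2ennreal (- x)"
proof (cases x)
  case (real r)
  then show ?thesis
    using assms by (cases "r \<ge> 0") (auto simp: ennreal_neg simp flip: ennreal_plus)
qed (use assms in auto)

text \<open>The previous identity is integrated. The upper bound makes the positive part integrable,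
  so the integrals of K - f and of the negative part are finite or infinite together.\<close>

lemma ereal_integral_eq_bound_minus:
  assumes "finite_measure M" and [measurable]: "f \<in> borel_measurable M"
    and bound: "AE x in M. f x \<le> ereal K" and "0 \<le> K"
  shows "ereal_integral M f =
    ereal (K * measure M (space M)) - enn2ereal (\<integral>\<^sup>+ x. e2ennreal (ereal K - f x) \<partial>M)"
proof -
  interpret finite_measure M by fact
  define I where "I = (\<integral>\<^sup>+ x. e2ennreal (ereal K - f x) \<partial>M)"
  define P where "P = (\<integral>\<^sup>+ x. e2ennreal (f x) \<partial>M)"
  define N where "N = (\<integral>\<^sup>+ x. e2ennreal (- f x) \<partial>M)"
  define m where "m = measure M (space M)"
  have m: "emeasure M (space M) = ennreal m" "0 \<le> m"
    by (simp_all add: m_def emeasure_eq_measure)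
  have "I + P = (\<integral>\<^sup>+ x. e2ennreal (ereal K - f x) + e2ennreal (f x) \<partial>M)"
    unfolding I_def P_def by (subst nn_integral_add) auto
  also have "\<dots> = (\<integral>\<^sup>+ x. ennreal K + e2ennreal (- f x) \<partial>M)"
    using bound by (intro nn_integral_cong_AE) (auto elim!: eventually_mono simp: e2ennreal_bound_split assms(4))
  also have "\<dots> = ennreal K * ennreal m + N"
    unfolding N_def by (subst nn_integral_add) (auto simp: m)
  finally have eq: "I + P = ennreal (K * m) + N"
    using assms(4) m by (simp add: ennreal_mult)
  have "P \<le> (\<integral>\<^sup>+ x. ennreal K \<partial>M)"
    unfolding P_def using bound
    by (intro nn_integral_mono_AE) (auto elim!: eventually_mono dest!: e2ennreal_mono)
  also have "\<dots> < top" by (simp add: m ennreal_mult_less_top)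
  finally obtain p where p: "P = ennreal p" "0 \<le> p" by (cases P) auto
  have "enn2ereal P - enn2ereal N = ereal (K * m) - enn2ereal I"
  proof (cases N)
    case (real n)
    then have "I + P < top" using eq by (simp add: ennreal_add_less_top)
    then obtain i where i: "I = ennreal i" "0 \<le> i" by (cases I) auto
    have "ennreal (i + p) = ennreal (K * m + n)"
      using eq i p real assms(4) m by (simp add: ennreal_plus)
    then have "i + p = K * m + n"
      using i p real assms(4) m by (subst (asm) ennreal_inj) auto
    then show ?thesis using i p real by simp
  next
    case top
    then have "I + ennreal p = top" using eq p by simp
    then have "I = top" by (simp add: ennreal_add_eq_top)
    then show ?thesis using top p by simp
  qed
  then show ?thesis by (simp add: ereal_integral_def I_def P_def N_def m_def)
qed

lemma e2ennreal_mult_ereal: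
  assumes "0 \<le> g"
  shows "e2ennreal (x * ereal g) = ennreal g * e2ennreal x"
proof (cases x)
  case (real r)
  then show ?thesis using assms
    by (cases "0 \<le> r") (auto simp: ennreal_mult mult.commute ennreal_neg mult_nonneg_nonpos)
next
  case PInf
  then show ?thesis using assms by (cases "g = 0") (auto simp: ennreal_mult_top)
next
  case MInf
  then show ?thesis using assms by (cases "g = 0") (auto simp: e2ennreal_neg)
qed

text \<open>Moving the kernel into the measure turns a convolution into an average over
  translates.\<close>

lemma ereal_integral_density:
  assumes [measurable]: "f \<in> borel_measurable M" "g \<in> borel_measurable M" and "\<And>x. 0 \<le> g x"
  shows "ereal_integral M (\<lambda>x. f x * ereal (g x)) = ereal_integral (density M (\<lambda>x. ennreal (g x))) f"
proof -
  have "- (f x * ereal (g x)) = - f x * ereal (g x)" for x by simp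
  then show ?thesis
    unfolding ereal_integral_def
    by (simp only:) (simp add: nn_integral_density e2ennreal_mult_ereal assms(3) del: ereal_mult_minus_left)
qed

lemma less_e2ennreal_bound_minus_iff:
  "y < e2ennreal (ereal K - x) \<longleftrightarrow> x < ereal K - enn2ereal y"
proof (cases y)
  case (real r)
  then show ?thesis by (cases x) (auto simp: ennreal_less_iff e2ennreal_neg)
next
  case top
  then show ?thesis by auto
qed

lemma bound_minus_enn2ereal_less_iff:
  "ereal K - enn2ereal g < c \<longleftrightarrow> c = \<infinity> \<or> (\<exists>c'. c = ereal c' \<and> (K < c' \<or> ennreal (K - c') < g))"
proof (cases g)
  case (real r)
  have "K - r < x \<longleftrightarrow> K < x \<or> ennreal (K - x) < ennreal r" for x
    using \<open>0 \<le> r\<close> by (cases "K - x \<ge> 0") (auto simp: ennreal_less_iff)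
  then show ?thesis using real by (cases c) auto
next
  case top
  then show ?thesis by (cases c) auto
qed

text \<open>The sub-mean inequality for u is the reverse inequality for K - u, which can be stated
  in \<open>ennreal\<close> and integrated further.\<close>

lemma le_mean_iff:
  assumes "x \<le> ereal K"
  shows "x \<le> ereal (1 / (2 * pi)) * (ereal (K * (2 * pi)) - enn2ereal J) \<longleftrightarrow>
    J \<le> ennreal (2 * pi) * e2ennreal (ereal K - x)"
proof (cases x)
  case (real r)
  then have r: "r \<le> K" using assms by simp
  show ?thesis
  proof (cases J)
    case (real j)
    have "r \<le> 1 / (2 * pi) * (K * (2 * pi) - j) \<longleftrightarrow> j \<le> 2 * pi * (K - r)"
      by (simp add: field_simps)
    then show ?thesis using real \<open>x = ereal r\<close> r by (simp add: ennreal_mult[symmetric])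
  next
    case top
    then show ?thesis using \<open>x = ereal r\<close> by (simp add: ennreal_mult[symmetric] r top_unique)
  qed
next
  case MInf
  then show ?thesis by (simp add: ennreal_mult_top)
qed (use assms in auto)

section \<open>Smoothing plurisubharmonic functions\<close>

lemma usc_imp_open: "usc u \<Longrightarrow> open {z. u z < c}"
  unfolding open_subopen[of "{z. u z < c}"]
proof
  fix z assume u: "usc u" and z: "z \<in> {z. u z < c}"
  then have "\<forall>\<^sub>F w in nhds z. u w < c"
    by (auto simp: eventually_nhds_conv_at usc_def)
  then show "\<exists>T. open T \<and> z \<in> T \<and> T \<subseteq> {z. u z < c}"
    by (auto simp: eventually_nhds)
qed

lemma usc_imp_borel_measurable: "usc u \<Longrightarrow> u \<in> borel_measurable borel"
  by (rule borel_measurableI_less) (simp add: usc_imp_open borel_open)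

text \<open>This is lower semicontinuity of K - u in the sequential form that Fatou's lemma
  needs.\<close>

lemma bound_minus_usc_le_liminf:
  assumes "usc u" "X \<longlonglongrightarrow> z"
  shows "e2ennreal (ereal K - u z) \<le> liminf (\<lambda>n. e2ennreal (ereal K - u (X n)))"
  unfolding le_Liminf_iff
proof (intro allI impI)
  fix y assume "y < e2ennreal (ereal K - u z)"
  then have "z \<in> {w. u w < ereal K - enn2ereal y}" by (simp add: less_e2ennreal_bound_minus_iff)
  from topological_tendstoD[OF assms(2) usc_imp_open[OF assms(1)] this]
  show "\<forall>\<^sub>F n in sequentially. y < e2ennreal (ereal K - u (X n))"
    by (simp add: less_e2ennreal_bound_minus_iff)
qed

text \<open>With an upper bound K of u near the points involved, the convolution is K minus the
  integral of the nonnegative function K - u. Upper semicontinuity is then Fatou's lemma, and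
  the sub-mean value property is Tonelli's theorem.\<close>

lemma psh_convolution_measure:
  fixes u :: "complex^'n \<Rightarrow> ereal" and \<mu> :: "(complex^'n) measure"
  assumes prob: "prob_space \<mu>" and sets [measurable_cong]: "sets \<mu> = sets borel"
    and supp: "AE \<xi> in \<mu>. norm \<xi> \<le> R"
    and psh: "psh u"
    and bdd: "\<And>r. \<exists>K::real. \<forall>z. norm z \<le> r \<longrightarrow> u z \<le> ereal K"
  shows "psh (\<lambda>z. ereal_integral \<mu> (\<lambda>\<xi>. u (z - \<xi>)))"
proof -
  interpret prob_space \<mu> by fact
  define v where "v = (\<lambda>z. ereal_integral \<mu> (\<lambda>\<xi>. u (z - \<xi>)))"
  define G where "G = (\<lambda>K z. \<integral>\<^sup>+ \<xi>. e2ennreal (ereal K - u (z - \<xi>)) \<partial>\<mu>)"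
  have usc: "usc u" using psh by (simp add: psh_def)
  have meas [measurable]: "u \<in> borel_measurable borel" by (rule usc_imp_borel_measurable[OF usc])
  \<comment> \<open>The points \<open>z - \<xi>\<close> stay in the ball of radius
    \<open>r + R\<close>. The maximum with 0 supplies the sign of K required by the reduction to K -
    u.\<close>
  have bound: "\<exists>K\<ge>0. \<forall>z \<xi>. norm z \<le> r \<longrightarrow> norm \<xi> \<le> R \<longrightarrow> u (z - \<xi>) \<le> ereal K" for r
  proof -
    obtain K where K: "\<And>z. norm z \<le> r + R \<Longrightarrow> u z \<le> ereal K" using bdd[of "r + R"] by blast
    have "u (z - \<xi>) \<le> ereal (max K 0)" if "norm z \<le> r" "norm \<xi> \<le> R" for z \<xi> :: "complex^'n"
    proof -
      have "norm (z - \<xi>) \<le> r + R" using that norm_triangle_ineq4[of z \<xi>] by simp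
      from K[OF this] show ?thesis by (rule order_trans) simp
    qed
    then show ?thesis by (intro exI[of _ "max K 0"]) auto
  qed
  have v_eq: "v z = ereal K - enn2ereal (G K z)"
    if "AE \<xi> in \<mu>. u (z - \<xi>) \<le> ereal K" "0 \<le> K" for z K
    unfolding v_def G_def using that
    by (subst ereal_integral_eq_bound_minus[where K = K]) (auto simp: prob_space finite_measure_axioms)
  have v_le: "v z \<le> ereal K" if "AE \<xi> in \<mu>. u (z - \<xi>) \<le> ereal K" "0 \<le> K" for z K
    unfolding v_eq[OF that] by (cases "G K z") auto
  have uscv: "usc v"
    unfolding usc_def
  proof (intro allI impI)
    fix z c assume vz: "v z < c"
    obtain K where K0: "K \<ge> 0" "\<And>w \<xi>. norm w \<le> norm z + 1 \<Longrightarrow> norm \<xi> \<le> R \<Longrightarrow> u (w - \<xi>) \<le> ereal K"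
      using bound[of "norm z + 1"] by blast
    have K: "AE \<xi> in \<mu>. u (w - \<xi>) \<le> ereal K" if "norm w \<le> norm z + 1" for w
      using eventually_mono[OF supp K0(2)[OF that]] .
    show "\<forall>\<^sub>F w in at z. v w < c"
    proof (rule sequentially_imp_eventually_within, safe)
      fix X :: "nat \<Rightarrow> complex^'n" assume X: "X \<longlonglongrightarrow> z"
      have "(\<lambda>n. norm (X n)) \<longlonglongrightarrow> norm z" using X by (rule tendsto_norm)
      then have "\<forall>\<^sub>F n in sequentially. norm (X n) < norm z + 1" by (rule order_tendstoD) simp
      then have evX: "\<forall>\<^sub>F n in sequentially. v (X n) = ereal K - enn2ereal (G K (X n))"
        by (rule eventually_mono) (auto intro!: v_eq K K0(1))
      have "G K z \<le> (\<integral>\<^sup>+ \<xi>. liminf (\<lambda>n. e2ennreal (ereal K - u (X n - \<xi>))) \<partial>\<mu>)"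
        unfolding G_def using X
        by (intro nn_integral_mono bound_minus_usc_le_liminf usc tendsto_intros)
      also have "\<dots> \<le> liminf (\<lambda>n. G K (X n))"
        unfolding G_def by (rule nn_integral_liminf) measurable
      finally have lim: "G K z \<le> liminf (\<lambda>n. G K (X n))" .
      have "ereal K - enn2ereal (G K z) < c" using vz v_eq[OF K K0(1), of z] by simp
      then have "\<forall>\<^sub>F n in sequentially. ereal K - enn2ereal (G K (X n)) < c"
        unfolding bound_minus_enn2ereal_less_iff using lim
        by (auto simp: le_Liminf_iff elim!: eventually_mono)
      then show "\<forall>\<^sub>F n in sequentially. v (X n) < c"
        using evX by eventually_elim simp
    qed
  qed
  have "v (a + \<zeta> *s b) \<le> ereal (1 / (2*pi)) *
      ereal_integral (lebesgue_on {0..2*pi}) (\<lambda>\<theta>. v (a + (\<zeta> + of_real r * cis \<theta>) *s b))"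
    if r: "r > 0" for a b \<zeta> r
  proof -
    define y where "y = (\<lambda>\<theta>. a + (\<zeta> + of_real r * cis \<theta>) *s b)"
    define L where "L = lebesgue_on {0..2*pi}"
    have cy: "continuous_on UNIV y"
      unfolding y_def vector_scalar_mult_def by (intro continuous_intros)
    have "bounded (y ` {0..2*pi})"
      by (intro compact_imp_bounded compact_continuous_image continuous_on_subset[OF cy]) auto
    then obtain \<rho>0 where \<rho>0: "\<And>\<theta>. \<theta> \<in> {0..2*pi} \<Longrightarrow> norm (y \<theta>) \<le> \<rho>0"
      unfolding bounded_iff by blast
    \<comment> \<open>The radius covers the centre as well as the circle, so one K serves both sides
      of the sub-mean inequality.\<close>
    define \<rho> where "\<rho> = max \<rho>0 (norm (a + \<zeta> *s b))"
    have y\<rho>: "norm (y \<theta>) \<le> \<rho>" if "\<theta> \<in> {0..2*pi}" for \<theta>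
      using \<rho>0[OF that] by (simp add: \<rho>_def)
    obtain K where K: "K \<ge> 0" "\<And>w \<xi>. norm w \<le> \<rho> \<Longrightarrow> norm \<xi> \<le> R \<Longrightarrow> u (w - \<xi>) \<le> ereal K"
      using bound[of \<rho>] by blast
    have KAE: "AE \<xi> in \<mu>. u (w - \<xi>) \<le> ereal K" if "norm w \<le> \<rho>" for w
      using eventually_mono[OF supp K(2)[OF that]] .
    interpret L: finite_measure L
      unfolding L_def by (rule finite_measure_lebesgue_on) (metis lmeasurable_cbox interval_cbox)
    interpret pair_sigma_finite L \<mu> ..
    have space_L: "space L = {0..2*pi}" by (simp add: L_def)
    have measure_L: "measure L (space L) = 2 * pi"
      by (simp add: L_def measure_restrict_space)
    have [measurable]: "y \<in> L \<rightarrow>\<^sub>M borel"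
      unfolding L_def
      by (intro measurable_restrict_space1 measurable_completion) (simp add: borel_measurable_continuous_onI cy)
    have [measurable]: "v \<in> borel_measurable borel" by (rule usc_imp_borel_measurable[OF uscv])
    define J where "J = (\<integral>\<^sup>+ \<theta>. G K (y \<theta>) \<partial>L)"
    have "ereal_integral L (\<lambda>\<theta>. v (y \<theta>)) =
        ereal (K * measure L (space L)) - enn2ereal (\<integral>\<^sup>+ \<theta>. e2ennreal (ereal K - v (y \<theta>)) \<partial>L)"
      using K(1) y\<rho> KAE v_le
      by (intro ereal_integral_eq_bound_minus L.finite_measure_axioms AE_I2) (auto simp: space_L)
    also have "(\<integral>\<^sup>+ \<theta>. e2ennreal (ereal K - v (y \<theta>)) \<partial>L) = J"
      unfolding J_def
    proof (rule nn_integral_cong)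
      fix \<theta> assume "\<theta> \<in> space L"
      then have "v (y \<theta>) = ereal K - enn2ereal (G K (y \<theta>))"
        using y\<rho> by (intro v_eq KAE K) (auto simp: space_L)
      then show "e2ennreal (ereal K - v (y \<theta>)) = G K (y \<theta>)" by (cases "G K (y \<theta>)") auto
    qed
    finally have int_v: "ereal_integral L (\<lambda>\<theta>. v (y \<theta>)) = ereal (K * (2 * pi)) - enn2ereal J"
      by (simp add: measure_L)
    have "J = (\<integral>\<^sup>+ \<xi>. (\<integral>\<^sup>+ \<theta>. e2ennreal (ereal K - u (y \<theta> - \<xi>)) \<partial>L) \<partial>\<mu>)"
      unfolding J_def G_def by (rule Fubini'[symmetric]) measurable
    also have "\<dots> \<le> (\<integral>\<^sup>+ \<xi>. ennreal (2 * pi) * e2ennreal (ereal K - u (a + \<zeta> *s b - \<xi>)) \<partial>\<mu>)"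
    proof (rule nn_integral_mono_AE, rule eventually_mono[OF supp])
      fix \<xi> :: "complex^'n" assume \<xi>: "norm \<xi> \<le> R"
      have le: "u (a + \<zeta> *s b - \<xi>) \<le> ereal K" by (rule K(2)[OF _ \<xi>]) (simp add: \<rho>_def)
      have "u (a - \<xi> + \<zeta> *s b) \<le> ereal (1 / (2*pi)) * ereal_integral L (\<lambda>\<theta>. u (a - \<xi> + (\<zeta> + of_real r * cis \<theta>) *s b))"
        using psh r unfolding psh_def L_def by blast
      moreover have "a - \<xi> + x = a + x - \<xi>" for x by simp
      ultimately have "u (a + \<zeta> *s b - \<xi>) \<le> ereal (1 / (2*pi)) * ereal_integral L (\<lambda>\<theta>. u (y \<theta> - \<xi>))"
        by (simp add: y_def)
      also have "ereal_integral L (\<lambda>\<theta>. u (y \<theta> - \<xi>)) = ereal (K * measure L (space L)) -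
          enn2ereal (\<integral>\<^sup>+ \<theta>. e2ennreal (ereal K - u (y \<theta> - \<xi>)) \<partial>L)"
        using K(1) K(2)[OF y\<rho> \<xi>]
        by (intro ereal_integral_eq_bound_minus L.finite_measure_axioms AE_I2) (auto simp: space_L)
      finally show "(\<integral>\<^sup>+ \<theta>. e2ennreal (ereal K - u (y \<theta> - \<xi>)) \<partial>L) \<le>
          ennreal (2 * pi) * e2ennreal (ereal K - u (a + \<zeta> *s b - \<xi>))"
        unfolding measure_L le_mean_iff[OF le] .
    qed
    also have "\<dots> = ennreal (2 * pi) * G K (a + \<zeta> *s b)"
      unfolding G_def by (rule nn_integral_cmult) measurable
    also have "G K (a + \<zeta> *s b) = e2ennreal (ereal K - v (a + \<zeta> *s b))"
    proof -
      have "v (a + \<zeta> *s b) = ereal K - enn2ereal (G K (a + \<zeta> *s b))"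
        by (intro v_eq KAE K) (simp add: \<rho>_def)
      then show ?thesis by (cases "G K (a + \<zeta> *s b)") auto
    qed
    finally have "v (a + \<zeta> *s b) \<le> ereal (1 / (2*pi)) * (ereal (K * (2 * pi)) - enn2ereal J)"
      by (subst le_mean_iff) (auto intro!: v_le KAE K simp: \<rho>_def)
    then show ?thesis using int_v by (simp add: L_def y_def)
  qed
  moreover have "v z \<noteq> \<infinity>" for z
  proof -
    obtain K where K: "K \<ge> 0" "\<And>w \<xi>. norm w \<le> norm z \<Longrightarrow> norm \<xi> \<le> R \<Longrightarrow> u (w - \<xi>) \<le> ereal K"
      using bound[of "norm z"] by blast
    have "v z \<le> ereal K" by (rule v_le[OF eventually_mono[OF supp K(2)] K(1)]) auto
    then show ?thesis by auto
  qed
  ultimately show ?thesis using uscv unfolding psh_def v_def by blast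
qed

section \<open>Smoothing and translation in the class LS\<close>

definition mollifier_measure :: "(complex^'n \<Rightarrow> real) \<Rightarrow> real \<Rightarrow> (complex^'n) measure" where
  "mollifier_measure \<psi> \<delta> = density lborel (\<lambda>\<xi>. ennreal (scaled \<psi> \<delta> \<xi>))"

lemma sets_mollifier_measure [measurable_cong]: "sets (mollifier_measure \<psi> \<delta>) = sets borel"
  by (simp add: mollifier_measure_def)

lemma mollifier_borel_measurable:
  assumes "mollifier \<psi>"
  shows "\<psi> \<in> borel_measurable borel"
proof -
  have "Ck 0 \<psi>" using assms unfolding mollifier_def smooth_def by blast
  then show ?thesis by (intro borel_measurable_continuous_onI) simp
qed

lemma scaled_borel_measurable:
  assumes "mollifier \<psi>"
  shows "scaled \<psi> \<delta> \<in> borel_measurable borel"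
proof -
  note [measurable] = mollifier_borel_measurable[OF assms]
  show ?thesis unfolding scaled_def by measurable
qed

lemma scaled_nonneg:
  assumes "mollifier \<psi>" "0 < \<delta>"
  shows "0 \<le> scaled \<psi> \<delta> \<xi>"
proof -
  have "\<And>x. 0 \<le> \<psi> x" using assms(1) unfolding mollifier_def by blast
  then show ?thesis using assms(2) by (simp add: scaled_def)
qed

lemma prob_space_mollifier_measure:
  fixes \<psi> :: "complex^'n \<Rightarrow> real"
  assumes \<psi>: "mollifier \<psi>" and \<delta>: "0 < \<delta>"
  shows "prob_space (mollifier_measure \<psi> \<delta>)"
proof
  note [measurable] = mollifier_borel_measurable[OF \<psi>] scaled_borel_measurable[OF \<psi>, of \<delta>]
  have \<psi>0: "\<And>x. 0 \<le> \<psi> x" and \<psi>1: "integral\<^sup>L lborel \<psi> = 1"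
    using \<psi> unfolding mollifier_def by blast+
  \<comment> \<open>The integral of a nonintegrable function is 0 by default, so the value 1 forces
    integrability.\<close>
  have int: "integrable lborel \<psi>"
    using \<psi>1 not_integrable_integral_eq[of lborel \<psi>] by auto
  have "1 = (\<integral>\<^sup>+ x. ennreal (\<psi> x) \<partial>lborel)"
    using nn_integral_eq_integral[OF int] \<psi>0 \<psi>1 by simp
  \<comment> \<open>The Jacobian exponent \<open>DIM(complex^'n)\<close> is
    \<open>2 * CARD('n)\<close>, which matches the normalization in \<open>scaled\<close>.\<close>
  also have "\<dots> = (\<integral>\<^sup>+ x. ennreal (\<psi> x) \<partial>density (distr lborel borel (\<lambda>x. 0 + inverse \<delta> *\<^sub>R x)) (\<lambda>_. \<bar>inverse \<delta>\<bar> ^ DIM(complex^'n)))"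
    using \<delta> by (subst lborel_affine[of "inverse \<delta>" 0]) auto
  also have "\<dots> = (\<integral>\<^sup>+ x. ennreal (inverse \<delta> ^ DIM(complex^'n)) * ennreal (\<psi> (inverse \<delta> *\<^sub>R x)) \<partial>lborel)"
    using \<delta> by (subst nn_integral_density) (auto simp: nn_integral_distr)
  also have "\<dots> = (\<integral>\<^sup>+ x. ennreal (scaled \<psi> \<delta> x) \<partial>lborel)"
    using \<delta> \<psi>0 by (intro nn_integral_cong) (simp add: scaled_def ennreal_mult power_inverse mult.commute)
  finally show "emeasure (mollifier_measure \<psi> \<delta>) (space (mollifier_measure \<psi> \<delta>)) = 1"
    by (simp add: mollifier_measure_def emeasure_density)
qed

lemma mollifier_measure_bounded_support:
  assumes \<psi>: "mollifier \<psi>" and \<delta>: "0 < \<delta>"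
  obtains R where "0 \<le> R" "AE \<xi> in mollifier_measure \<psi> \<delta>. norm \<xi> \<le> R"
proof -
  obtain B where B: "0 < B" "\<And>\<zeta>. \<psi> \<zeta> \<noteq> 0 \<Longrightarrow> norm \<zeta> \<le> B"
    using \<psi> unfolding mollifier_def bounded_pos by blast
  have "norm \<xi> \<le> \<delta> * B" if "0 < scaled \<psi> \<delta> \<xi>" for \<xi>
  proof -
    have "\<psi> (inverse \<delta> *\<^sub>R \<xi>) \<noteq> 0" using that by (auto simp: scaled_def)
    from B(2)[OF this] show ?thesis using \<delta> by (simp add: field_simps)
  qed
  then have "AE \<xi> in mollifier_measure \<psi> \<delta>. norm \<xi> \<le> \<delta> * B"
    using scaled_borel_measurable[OF \<psi>, of \<delta>]
    unfolding mollifier_measure_def by (subst AE_density) auto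
  then show ?thesis using that[of "\<delta> * B"] B \<delta> by simp
qed

lemma convol_eq_ereal_integral:
  assumes "mollifier \<psi>" "0 < \<delta>" and [measurable]: "u \<in> borel_measurable borel"
  shows "convol u (scaled \<psi> \<delta>) z = ereal_integral (mollifier_measure \<psi> \<delta>) (\<lambda>\<xi>. u (z - \<xi>))"
proof -
  note [measurable] = scaled_borel_measurable[OF assms(1), of \<delta>]
  show ?thesis
    unfolding convol_def mollifier_measure_def
  proof (rule ereal_integral_density)
    show "(\<lambda>\<xi>. u (z - \<xi>)) \<in> borel_measurable lborel" by measurable
    show "scaled \<psi> \<delta> \<in> borel_measurable lborel" by simp
  qed (rule scaled_nonneg[OF assms(1,2)])
qed

lemma supnorm_le_norm:
  fixes w :: "complex^'n"
  shows "supnorm w \<le> norm w"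
proof -
  have "\<forall>a\<in>range (\<lambda>i. cmod (w $ i)). a \<le> norm w"
    using Finite_Cartesian_Product.norm_nth_le by blast
  then show ?thesis unfolding supnorm_def by (intro Max.boundedI) auto
qed

lemma convol_in_LS:
  fixes S :: "(real^'n) set"
  assumes S: "compact S" "S \<subseteq> nonneg_orthant" "0 \<in> S" "lower_set S"
    and u: "u \<in> LS S" and \<psi>: "mollifier \<psi>" and \<delta>: "0 < \<delta>"
  shows "convol u (scaled \<psi> \<delta>) \<in> LS S"
proof -
  have ne: "S \<noteq> {}" using S(3) by auto
  define \<mu> where "\<mu> = mollifier_measure \<psi> \<delta>"
  define \<sigma> where "\<sigma> = phiS S onevec"
  have \<sigma>: "0 \<le> \<sigma>" unfolding \<sigma>_def by (rule phiS_nonneg[OF S(1,3)])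
  interpret prob_space \<mu> unfolding \<mu>_def by (rule prob_space_mollifier_measure[OF \<psi> \<delta>])
  have [measurable_cong]: "sets \<mu> = sets borel" unfolding \<mu>_def by (rule sets_mollifier_measure)
  obtain R where R: "0 \<le> R" "AE \<xi> in \<mu>. norm \<xi> \<le> R"
    unfolding \<mu>_def by (rule mollifier_measure_bounded_support[OF \<psi> \<delta>])
  obtain c0 where psh: "psh u" and c0: "\<And>z. u z \<le> ereal c0 + HS S z"
    using u by (auto simp: LS_def)
  \<comment> \<open>The enlarged constant ensures that K below is nonnegative.\<close>
  define c where "c = max c0 0"
  have [measurable]: "u \<in> borel_measurable borel"
    using psh by (auto simp: psh_def intro: usc_imp_borel_measurable)
  define h where "h = (\<lambda>z. phiS S (logplus z))"
  have HS: "HS S z = ereal (h z)" for z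
    unfolding h_def by (rule HS_eq_phiS_logplus[OF S(1) ne S(2,4)])
  have h: "h (z - w) \<le> \<sigma> * norm w + h z" for z w
  proof -
    have "h (z - w) \<le> \<sigma> * supnorm w + h z"
      using HS_diff_le[OF S(1) ne S(2,4), of z w] by (simp add: HS \<sigma>_def)
    also have "\<dots> \<le> \<sigma> * norm w + h z"
      by (intro add_right_mono mult_left_mono supnorm_le_norm \<sigma>)
    finally show ?thesis .
  qed
  have uh: "u z \<le> ereal (c + h z)" for z
    using c0[of z] by (rule order_trans) (simp add: HS c_def)
  have "psh (\<lambda>z. ereal_integral \<mu> (\<lambda>\<xi>. u (z - \<xi>)))"
  proof (rule psh_convolution_measure[OF prob_space_axioms _ R(2) psh])
    fix r :: real
    have "u z \<le> ereal (c + (\<sigma> * r + h 0))" if "norm z \<le> r" for z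
    proof -
      \<comment> \<open>The Lipschitz estimate starting from the origin, with shift
        \<open>- z\<close>, bounds \<open>h\<close> on balls.\<close>
      have "c + h z \<le> c + (\<sigma> * r + h 0)"
        using h[of 0 "- z"] mult_left_mono[OF that \<sigma>] by simp
      then show ?thesis using uh[of z] by (meson ereal_less_eq(3) order_trans)
    qed
    then show "\<exists>K. \<forall>z. norm z \<le> r \<longrightarrow> u z \<le> ereal K" by blast
  qed (simp add: \<mu>_def sets_mollifier_measure)
  moreover have "ereal_integral \<mu> (\<lambda>\<xi>. u (z - \<xi>)) \<le> ereal (c + \<sigma> * R) + HS S z" for z
  proof -
    define K where "K = c + \<sigma> * R + h z"
    have "0 \<le> h z" unfolding h_def by (rule phiS_nonneg[OF S(1,3)])
    then have K: "0 \<le> K" using \<sigma> R(1) by (simp add: K_def c_def)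
    have "AE \<xi> in \<mu>. u (z - \<xi>) \<le> ereal K"
    proof (rule eventually_mono[OF R(2)])
      fix \<xi> :: "complex^'n" assume "norm \<xi> \<le> R"
      then have "c + h (z - \<xi>) \<le> K"
        using h[of z \<xi>] mult_left_mono[OF _ \<sigma>, of "norm \<xi>" R] by (simp add: K_def)
      then show "u (z - \<xi>) \<le> ereal K" using uh[of "z - \<xi>"] by (meson ereal_less_eq(3) order_trans)
    qed
    then have "ereal_integral \<mu> (\<lambda>\<xi>. u (z - \<xi>)) =
        ereal (K * measure \<mu> (space \<mu>)) - enn2ereal (\<integral>\<^sup>+ \<xi>. e2ennreal (ereal K - u (z - \<xi>)) \<partial>\<mu>)"
      by (intro ereal_integral_eq_bound_minus K finite_measure_axioms) auto
    also have "\<dots> \<le> ereal K"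
      by (cases "\<integral>\<^sup>+ \<xi>. e2ennreal (ereal K - u (z - \<xi>)) \<partial>\<mu>") (auto simp: prob_space)
    finally show ?thesis by (simp add: HS K_def)
  qed
  moreover have "convol u (scaled \<psi> \<delta>) = (\<lambda>z. ereal_integral \<mu> (\<lambda>\<xi>. u (z - \<xi>)))"
    using convol_eq_ereal_integral[OF \<psi> \<delta>, of u] by (simp add: fun_eq_iff \<mu>_def)
  ultimately show ?thesis unfolding LS_def by auto
qed

section \<open>Stability under translation\<close>

lemma psh_translate:
  assumes "psh u"
  shows "psh (\<lambda>z. u (z - w))"
proof -
  have usc: "usc u" using assms by (simp add: psh_def)
  have "usc (\<lambda>z. u (z - w))"
    unfolding usc_def
  proof (intro allI impI)
    fix z and c :: ereal assume "u (z - w) < c"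
    then have "z - w \<in> {z. u z < c}" by simp
    moreover have "((\<lambda>z. z - w) \<longlongrightarrow> z - w) (at z)" by (intro tendsto_intros)
    ultimately show "\<forall>\<^sub>F x in at z. u (x - w) < c"
      using topological_tendstoD[OF _ usc_imp_open[OF usc]] by fastforce
  qed
  moreover have "u (a + \<zeta> *s b - w) \<le> ereal (1 / (2*pi)) *
      ereal_integral (lebesgue_on {0..2*pi}) (\<lambda>\<theta>. u (a + (\<zeta> + of_real r * cis \<theta>) *s b - w))"
    if "r > 0" for a b \<zeta> r
  proof -
    have "u ((a - w) + \<zeta> *s b) \<le> ereal (1 / (2*pi)) *
      ereal_integral (lebesgue_on {0..2*pi}) (\<lambda>\<theta>. u ((a - w) + (\<zeta> + of_real r * cis \<theta>) *s b))"
      using assms that unfolding psh_def by blast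
    moreover have "(a - w) + x = a + x - w" for x by simp
    ultimately show ?thesis by simp
  qed
  ultimately show ?thesis using assms unfolding psh_def by blast
qed

lemma translate_in_LS:
  fixes S :: "(real^'n) set"
  assumes S: "compact S" "S \<noteq> {}" "S \<subseteq> nonneg_orthant" "lower_set S" and u: "u \<in> LS S"
  shows "(\<lambda>z. u (z - w)) \<in> LS S"
proof -
  obtain c where psh: "psh u" and c: "\<And>z. u z \<le> ereal c + HS S z"
    using u by (auto simp: LS_def)
  have "u (z - w) \<le> ereal (c + phiS S onevec * supnorm w) + HS S z" for z
  proof -
    have "u (z - w) \<le> ereal c + HS S (z - w)" by (rule c)
    also have "\<dots> \<le> ereal c + (ereal (phiS S onevec * supnorm w) + HS S z)"
      by (intro add_left_mono HS_diff_le[OF S])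
    finally show ?thesis by (simp add: add.assoc[symmetric])
  qed
  then show ?thesis using psh_translate[OF psh] unfolding LS_def by blast
qed

text \<open>For x < 0 the logarithm converges to the finite number \<open>ln (cmod w)\<close>. For x
  > 0 the exponential is factored out and the remaining factor tends to 1.\<close>

lemma ln_cmod_exp_minus_div_tendsto:
  fixes w :: complex
  assumes "w \<noteq> 0" "w \<noteq> 1"
  shows "(\<lambda>n. ln (cmod (of_real (exp (real n * x)) - w)) / real n) \<longlonglongrightarrow> max x 0"
proof -
  consider "x < 0" | "x = 0" | "x > 0" by linarith
  then show ?thesis
  proof cases
    case 1
    have "(\<lambda>n. exp (real n * x)) \<longlonglongrightarrow> 0"
      using 1 LIMSEQ_power_zero[of "exp x"] by (simp add: exp_of_nat_mult)
    then have "(\<lambda>n. ln (cmod (of_real (exp (real n * x)) - w))) \<longlonglongrightarrow> ln (cmod (of_real 0 - w))"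
      using assms by (intro tendsto_intros) auto
    from tendsto_divide_0[OF this filterlim_at_top_imp_at_infinity[OF filterlim_real_sequentially]]
    show ?thesis using 1 by simp
  next
    case 2
    then show ?thesis
      using tendsto_divide_0[OF tendsto_const filterlim_at_top_imp_at_infinity[OF filterlim_real_sequentially]] by simp
  next
    case 3
    have "(\<lambda>n. exp (real n * (- x))) \<longlonglongrightarrow> 0"
      using 3 LIMSEQ_power_zero[of "exp (- x)"] by (simp only: exp_of_nat_mult) simp
    then have lim: "(\<lambda>n. 1 - w * of_real (exp (real n * (- x)))) \<longlonglongrightarrow> 1 - w * of_real 0"
      by (intro tendsto_intros)
    then have "(\<lambda>n. ln (cmod (1 - w * of_real (exp (real n * (- x)))))) \<longlonglongrightarrow> ln (cmod (1 - w * of_real 0))"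
      by (intro tendsto_ln tendsto_norm) auto
    from tendsto_divide_0[OF this filterlim_at_top_imp_at_infinity[OF filterlim_real_sequentially]]
    have "(\<lambda>n. x + ln (cmod (1 - w * of_real (exp (real n * (- x))))) / real n) \<longlonglongrightarrow> x + 0"
      by (intro tendsto_add tendsto_const)
    moreover have "\<forall>\<^sub>F n in sequentially. x + ln (cmod (1 - w * of_real (exp (real n * (- x))))) / real n =
        ln (cmod (of_real (exp (real n * x)) - w)) / real n"
    proof -
      have "\<forall>\<^sub>F n in sequentially. 1 - w * of_real (exp (real n * (- x))) \<noteq> 0"
        using tendsto_imp_eventually_ne[OF lim, of 0] by simp
      then show ?thesis using eventually_gt_at_top[of 0]
      proof eventually_elim
        case (elim n)
        have "of_real (exp (real n * x)) - w = of_real (exp (real n * x)) * (1 - w * of_real (exp (real n * (- x))))"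
          by (simp add: algebra_simps exp_minus flip: of_real_mult)
        then have "ln (cmod (of_real (exp (real n * x)) - w)) = real n * x + ln (cmod (1 - w * of_real (exp (real n * (- x)))))"
          using elim by (simp only: norm_mult) (subst ln_mult; simp)
        then show ?case using elim by (simp add: field_simps)
      qed
    qed
    ultimately show ?thesis using 3 by (auto intro: Lim_transform_eventually)
  qed
qed

text \<open>Real hyperplanes are null. A nonzero imaginary part keeps a coordinate away from 0, from
  1 and from all the real numbers \<open>exp (n * \<xi> $ j)\<close> at once.\<close>

lemma AE_lborel_Im_nth_neq_0: "AE \<zeta> in lborel. Im ((\<zeta> :: complex^'n) $ j) \<noteq> 0"
proof -
  have "axis j \<i> \<in> Basis" by (simp add: axis_in_Basis_iff Basis_complex_def)
  from AE_lborel_inner_neq[OF this, of 0] show ?thesis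
    by (simp add: inner_axis)
qed

text \<open>Fatou's lemma applied to the witness at expvec (n \<xi>) - \<zeta>, divided by n: for almost
  every \<zeta> the logarithms of its coordinates grow at the rate of the positive part of \<xi>.\<close>

lemma phiS_posvec_if_convol_in_LS:
  fixes S :: "(real^'n) set"
  assumes S: "compact S" "S \<subseteq> nonneg_orthant" "0 \<in> S"
    and conv: "\<And>u \<psi> \<delta>. u \<in> LS S \<Longrightarrow> mollifier \<psi> \<Longrightarrow> 0 < \<delta> \<Longrightarrow> convol u (scaled \<psi> \<delta>) \<in> LS S"
  shows "phiS S \<xi> = phiS S (posvec \<xi>)"
proof (rule antisym)
  have ne: "S \<noteq> {}" using S(3) by auto
  show "phiS S \<xi> \<le> phiS S (posvec \<xi>)"
    using S ne by (intro phiS_mono) auto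
  show "phiS S (posvec \<xi>) \<le> phiS S \<xi>"
    unfolding phiS_le_iff[OF S(1) ne]
  proof
    fix s assume s: "s \<in> S"
    have s0: "\<And>j. 0 \<le> s $ j" using s S(2) by (auto simp: nonneg_orthant_def)
    obtain \<psi> :: "complex^'n \<Rightarrow> real" where \<psi>: "mollifier \<psi>" using ex_mollifier by blast
    define \<mu> where "\<mu> = mollifier_measure \<psi> 1"
    interpret prob_space \<mu> unfolding \<mu>_def by (rule prob_space_mollifier_measure[OF \<psi>]) simp
    have [measurable_cong]: "sets \<mu> = sets borel" unfolding \<mu>_def by (rule sets_mollifier_measure)
    have [measurable]: "log_monomial s \<in> borel_measurable borel"
      by (rule borel_measurable_continuous_onI[OF continuous_on_log_monomial])
    have "convol (\<lambda>z. ereal (log_monomial s z)) (scaled \<psi> 1) \<in> LS S"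
      by (intro conv log_monomial_in_LS S s \<psi>) simp
    then obtain c where c: "\<And>z. convol (\<lambda>z. ereal (log_monomial s z)) (scaled \<psi> 1) z \<le> ereal c + HS S z"
      by (auto simp: LS_def)
    have conv_eq: "convol (\<lambda>z. ereal (log_monomial s z)) (scaled \<psi> 1) z =
        enn2ereal (\<integral>\<^sup>+ \<zeta>. ennreal (log_monomial s (z - \<zeta>)) \<partial>\<mu>)" for z
      using convol_eq_ereal_integral[OF \<psi>, of 1 "\<lambda>z. ereal (log_monomial s z)" z]
      by (simp add: ereal_integral_def ennreal_neg log_monomial_nonneg \<mu>_def zero_ennreal.rep_eq)
    define z where "z = (\<lambda>n::nat. expvec (real n *\<^sub>R \<xi>))"
    define g where "g = (\<lambda>n \<zeta>. ennreal (log_monomial s (z n - \<zeta>) / real n))"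
    \<comment> \<open>The absolute value keeps the bound nonnegative, so \<open>ennreal\<close> does
      not truncate it; the first term vanishes in the limit.\<close>
    have g_le: "(\<integral>\<^sup>+ \<zeta>. g n \<zeta> \<partial>\<mu>) \<le> ennreal (\<bar>c\<bar> / real n + phiS S \<xi>)" if n: "n > 0" for n
    proof -
      have "enn2ereal (\<integral>\<^sup>+ \<zeta>. ennreal (log_monomial s (z n - \<zeta>)) \<partial>\<mu>) \<le> ereal (c + phiS S (real n *\<^sub>R \<xi>))"
        using c[of "z n"] unfolding conv_eq by (simp add: z_def HS_expvec)
      also have "\<dots> \<le> ereal (\<bar>c\<bar> + real n * phiS S \<xi>)"
        using phiS_scaleR_le[OF S(1) ne, of "real n" \<xi>] by simp
      finally have le: "(\<integral>\<^sup>+ \<zeta>. ennreal (log_monomial s (z n - \<zeta>)) \<partial>\<mu>) \<le> ennreal (\<bar>c\<bar> + real n * phiS S \<xi>)"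
        by (metis e2ennreal_enn2ereal e2ennreal_ereal e2ennreal_mono)
      have "(\<integral>\<^sup>+ \<zeta>. g n \<zeta> \<partial>\<mu>) = (\<integral>\<^sup>+ \<zeta>. ennreal (1 / real n) * ennreal (log_monomial s (z n - \<zeta>)) \<partial>\<mu>)"
        unfolding g_def by (intro nn_integral_cong) (simp add: ennreal_mult[symmetric] log_monomial_nonneg)
      also have "\<dots> = ennreal (1 / real n) * (\<integral>\<^sup>+ \<zeta>. ennreal (log_monomial s (z n - \<zeta>)) \<partial>\<mu>)"
        by (rule nn_integral_cmult) measurable
      also have "\<dots> \<le> ennreal (1 / real n) * ennreal (\<bar>c\<bar> + real n * phiS S \<xi>)"
        by (intro mult_left_mono le) simp
      also have "\<dots> = ennreal (\<bar>c\<bar> / real n + phiS S \<xi>)"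
        using n phiS_nonneg[OF S(1,3), of \<xi>] by (subst ennreal_mult[symmetric]) (auto simp: add_divide_distrib)
      finally show ?thesis .
    qed
    have "AE \<zeta> in lborel. \<forall>j. Im ((\<zeta> :: complex^'n) $ j) \<noteq> 0"
      by (intro eventually_all_finite AE_lborel_Im_nth_neq_0)
    then have "AE \<zeta> in \<mu>. \<forall>j. Im (\<zeta> $ j) \<noteq> 0"
      using scaled_borel_measurable[OF \<psi>, of 1]
      unfolding \<mu>_def mollifier_measure_def by (subst AE_density) (auto elim!: eventually_mono)
    then have "AE \<zeta> in \<mu>. ennreal (inner s (posvec \<xi>)) \<le> liminf (\<lambda>n. g n \<zeta>)"
    proof (rule eventually_mono)
      fix \<zeta> :: "complex^'n" assume \<zeta>: "\<forall>j. Im (\<zeta> $ j) \<noteq> 0"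
      define f where "f = (\<lambda>n. \<Sum>j\<in>UNIV. s $ j * (ln (cmod (of_real (exp (real n * \<xi> $ j)) - \<zeta> $ j)) / real n))"
      have "f \<longlonglongrightarrow> (\<Sum>j\<in>UNIV. s $ j * max (\<xi> $ j) 0)"
        unfolding f_def using \<zeta> by (intro tendsto_intros ln_cmod_exp_minus_div_tendsto) (metis zero_complex.simps(2), metis one_complex.simps(2))
      then have "f \<longlonglongrightarrow> inner s (posvec \<xi>)" by (simp add: inner_vec_def)
      then have "(\<lambda>n. ennreal (f n)) \<longlonglongrightarrow> ennreal (inner s (posvec \<xi>))" by (rule tendsto_ennrealI)
      then have "ennreal (inner s (posvec \<xi>)) = liminf (\<lambda>n. ennreal (f n))"
        by (simp add: lim_imp_Liminf)
      also have "\<dots> \<le> liminf (\<lambda>n. g n \<zeta>)"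
      proof (rule Liminf_mono)
        show "\<forall>\<^sub>F n in sequentially. ennreal (f n) \<le> g n \<zeta>"
        proof (rule always_eventually, rule allI)
          fix n
          have "(z n - \<zeta>) $ j \<noteq> 0" for j
            using \<zeta> by (auto simp: z_def expvec_def complex_eq_iff)
          then have "inner s (logabs (z n - \<zeta>)) \<le> log_monomial s (z n - \<zeta>)"
            using s0 by (subst log_monomial_eq) auto
          \<comment> \<open>At n = 0 both sides are 0 because division by 0 gives 0, so the
            comparison holds for every n.\<close>
          moreover have "f n = inner s (logabs (z n - \<zeta>)) / real n"
            by (simp add: f_def inner_vec_def logabs_def z_def expvec_def sum_divide_distrib)
          ultimately show "ennreal (f n) \<le> g n \<zeta>"
            unfolding g_def by (intro ennreal_leI) (simp add: divide_right_mono)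
        qed
      qed
      finally show "ennreal (inner s (posvec \<xi>)) \<le> liminf (\<lambda>n. g n \<zeta>)" .
    qed
    then have "(\<integral>\<^sup>+ \<zeta>. ennreal (inner s (posvec \<xi>)) \<partial>\<mu>) \<le> (\<integral>\<^sup>+ \<zeta>. liminf (\<lambda>n. g n \<zeta>) \<partial>\<mu>)"
      by (rule nn_integral_mono_AE)
    also have "\<dots> \<le> liminf (\<lambda>n. \<integral>\<^sup>+ \<zeta>. g n \<zeta> \<partial>\<mu>)"
      unfolding g_def by (rule nn_integral_liminf) measurable
    also have "\<dots> \<le> liminf (\<lambda>n. ennreal (\<bar>c\<bar> / real n + phiS S \<xi>))"
      by (rule Liminf_mono) (rule eventually_mono[OF eventually_gt_at_top[of 0]], rule g_le)
    also have "\<dots> = ennreal (phiS S \<xi>)"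
    proof (rule lim_imp_Liminf)
      have "(\<lambda>n. \<bar>c\<bar> / real n + phiS S \<xi>) \<longlonglongrightarrow> 0 + phiS S \<xi>"
        by (intro tendsto_add tendsto_const tendsto_divide_0[OF tendsto_const filterlim_at_top_imp_at_infinity[OF filterlim_real_sequentially]])
      then show "(\<lambda>n. ennreal (\<bar>c\<bar> / real n + phiS S \<xi>)) \<longlonglongrightarrow> ennreal (phiS S \<xi>)"
        by (intro tendsto_ennrealI) simp
    qed simp
    finally show "inner s (posvec \<xi>) \<le> phiS S \<xi>"
      using phiS_nonneg[OF S(1,3), of \<xi>] by (simp add: emeasure_space_1)
  qed
qed

theorem theorem5p8:
  fixes S :: "(real^'n) set"
  assumes "S \<subseteq> nonneg_orthant" and "compact S" and "convex S" and "0 \<in> S"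
  defines "\<sigma> \<equiv> phiS S onevec"
  shows
   "(lower_set S \<longleftrightarrow> S = S_hat S)
  \<and> (lower_set S \<longleftrightarrow> (\<forall>\<xi>. phiS S \<xi> = phiS S (posvec \<xi>)))
  \<and> (lower_set S \<longleftrightarrow> (\<forall>z w. HS S (z - w) \<le> ereal (\<sigma> * supnorm w) + HS S z))
  \<and> (lower_set S \<longleftrightarrow> (\<forall>u\<in>LS S. \<forall>w. (\<lambda>z. u (z - w)) \<in> LS S))
  \<and> (lower_set S \<longleftrightarrow> (\<forall>u\<in>LS S. \<forall>\<psi>. mollifier \<psi> \<longrightarrow>
                          (\<forall>\<delta>>0. convol u (scaled \<psi> \<delta>) \<in> LS S)))"
proof -
  have ne: "S \<noteq> {}" using assms(4) by auto
  have hat: "lower_set S" if "S = S_hat S" using lower_set_S_hat[of S] that by simp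
  have lower: "lower_set S" if "\<And>\<xi>. phiS S \<xi> = phiS S (posvec \<xi>)"
    by (rule hat[OF S_hat_eq_if_phiS_posvec[OF assms(2,3) ne assms(1) that]])
  have phi: "phiS S \<xi> = phiS S (posvec \<xi>)" if "lower_set S" for \<xi>
    by (rule phiS_posvec_if_lower_set[OF assms(2) ne assms(1) that])
  \<comment> \<open>Here (iv) and (v) meet: each bounds every translate of the witness by a constant
    plus \<open>HS\<close>.\<close>
  have lower_translate: "lower_set S"
    if "\<And>s w. s \<in> S \<Longrightarrow> \<exists>c::real. \<forall>z. ereal (log_monomial s (z - w)) \<le> ereal c + HS S z"
    by (rule lower[OF phiS_posvec_if_translates_bounded[OF assms(2) ne assms(1) that]])
  have ii: "lower_set S \<longleftrightarrow> S = S_hat S"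
    using hat S_hat_eq_if_phiS_posvec[OF assms(2,3) ne assms(1) phi] by blast
  have iii: "lower_set S \<longleftrightarrow> (\<forall>\<xi>. phiS S \<xi> = phiS S (posvec \<xi>))"
    using phi lower by blast
  have iv: "lower_set S \<longleftrightarrow> (\<forall>z w. HS S (z - w) \<le> ereal (\<sigma> * supnorm w) + HS S z)"
  proof
    show "\<forall>z w. HS S (z - w) \<le> ereal (\<sigma> * supnorm w) + HS S z" if "lower_set S"
      unfolding \<sigma>_def using HS_diff_le[OF assms(2) ne assms(1) that] by blast
    show "lower_set S" if iv: "\<forall>z w. HS S (z - w) \<le> ereal (\<sigma> * supnorm w) + HS S z"
    proof (rule lower_translate)
      fix s :: "real^'n" and w :: "complex^'n" assume "s \<in> S"
      then show "\<exists>c::real. \<forall>z. ereal (log_monomial s (z - w)) \<le> ereal c + HS S z"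
        using iv log_monomial_le_HS[OF assms(2,1,4)] order_trans by blast
    qed
  qed
  have v: "lower_set S \<longleftrightarrow> (\<forall>u\<in>LS S. \<forall>w. (\<lambda>z. u (z - w)) \<in> LS S)"
  proof
    show "\<forall>u\<in>LS S. \<forall>w. (\<lambda>z. u (z - w)) \<in> LS S" if "lower_set S"
      using translate_in_LS[OF assms(2) ne assms(1) that] by blast
    show "lower_set S" if v: "\<forall>u\<in>LS S. \<forall>w. (\<lambda>z. u (z - w)) \<in> LS S"
    proof (rule lower_translate)
      fix s :: "real^'n" and w :: "complex^'n" assume "s \<in> S"
      then have "(\<lambda>z. ereal (log_monomial s (z - w))) \<in> LS S"
        using bspec[OF v log_monomial_in_LS[OF assms(2,1,4)]] by blast
      then show "\<exists>c::real. \<forall>z. ereal (log_monomial s (z - w)) \<le> ereal c + HS S z"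
        by (simp add: LS_def)
    qed
  qed
  have vi: "lower_set S \<longleftrightarrow> (\<forall>u\<in>LS S. \<forall>\<psi>. mollifier \<psi> \<longrightarrow> (\<forall>\<delta>>0. convol u (scaled \<psi> \<delta>) \<in> LS S))"
  proof
    show "\<forall>u\<in>LS S. \<forall>\<psi>. mollifier \<psi> \<longrightarrow> (\<forall>\<delta>>0. convol u (scaled \<psi> \<delta>) \<in> LS S)" if "lower_set S"
      using convol_in_LS[OF assms(2,1,4) that] by blast
    show "lower_set S" if "\<forall>u\<in>LS S. \<forall>\<psi>. mollifier \<psi> \<longrightarrow> (\<forall>\<delta>>0. convol u (scaled \<psi> \<delta>) \<in> LS S)"
      using that by (intro lower phiS_posvec_if_convol_in_LS[OF assms(2,1,4)]) blast
  qed
  show ?thesis using ii iii iv v vi by blast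
qed

end
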